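(* Let $\Psi:E\to\mathbb R$ satisfy $\int\Psi d\pi=0$ and suppose there exist $\alpha\in(1,2)$, $\alpha_1\in(0,2-\alpha)$ and constants $c_*^+,c_*^-\ge0$ with $c_*^++c_*^->0$, and $C^*>0$, such that $$\Big|\pi(\Psi>\lambda)-\frac{c_*^+}{\lambda^\alpha}\Big|+\Big|\pi(\Psi<-\lambda)-\frac{c_*^-}{\lambda^\alpha}\Big|\le\frac{C^*}{\lambda^{\alpha+\alpha_1}}\quad\text{for all }\lambda\ge1.$$ Let $Z^{(N)}_t=N^{-1/\alpha}\sum_{n=0}^{[Nt]}\Psi(\xi_n)$ and $$\psi(p)=\alpha\int_{\mathbb R}(1+i\lambda p-e^{i\lambda p})\frac{c_*(\lambda)d\lambda}{|\lambda|^{1+\alpha}},\qquad c_*(\lambda)=c_*^-\ (\lambda<0),\ c_*(\lambda)=c_*^+\ (\lambda>0).$$ Then for any $\delta\in(0,\alpha/(\alpha+1))$ there exists $C>0$ such that $$\big|\mathbb Ee^{ipZ^{(N)}_t}-e^{-t\psi(p)}\big|\le C(1+|p|)^5(t+1)\Big(\frac{1}{N^{\alpha_1/\alpha}}+\frac1{N^\delta}\Big)$$ for all $p\in\mathbb R$, $t\ge0$, $N\ge1$.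
   Context: $(E,d)$ is a Polish space and $\{\xi_n\}_{n\ge0}$ is a Markov chain on $E$ whose initial law $\pi$ is invariant and ergodic, with transition operator $P$. Assume the spectral gap condition $\sup\{\|Pf\|_{L^2(\pi)}:\|f\|_{L^2(\pi)}=1,\int fd\pi=0\}<1$, and that $P(w,dv)=p(w,v)\pi(dv)$ with $p\in L^\infty(\pi\otimes\pi)$. $[x]$ denotes the integer part. *)

theory Defs
  imports "HOL-Probability.Probability"
begin

definition trans_op :: "'a measure \<Rightarrow> ('a \<Rightarrow> 'a \<Rightarrow> real) \<Rightarrow> ('a \<Rightarrow> real) \<Rightarrow> 'a \<Rightarrow> real" where
  "trans_op \<pi> dens f w = (\<integral>v. dens w v * f v \<partial>\<pi>)"

text \<open>Iterated integral giving the finite-dimensional distributions of the chain: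
  P(xi_0 in A_0, ..., xi_n in A_n) = integral over pi of markov_fd dens pi [A_0,...,A_n].\<close>
fun markov_fd :: "'a measure \<Rightarrow> ('a \<Rightarrow> 'a \<Rightarrow> real) \<Rightarrow> 'a set list \<Rightarrow> 'a \<Rightarrow> real" where
  "markov_fd \<pi> dens [] x = 1"
| "markov_fd \<pi> dens (A # As) x = indicator A x * (\<integral>y. dens x y * markov_fd \<pi> dens As y \<partial>\<pi>)"

definition markov_chain :: "'w measure \<Rightarrow> (nat \<Rightarrow> 'w \<Rightarrow> 'a) \<Rightarrow> 'a measure \<Rightarrow> ('a \<Rightarrow> 'a \<Rightarrow> real) \<Rightarrow> bool" where
  "markov_chain M \<xi> \<pi> dens \<longleftrightarrow>
     (\<forall>n. \<xi> n \<in> measurable M \<pi>) \<and>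
     (\<forall>As. set As \<subseteq> sets \<pi> \<longrightarrow>
        measure M {\<omega> \<in> space M. \<forall>k<length As. \<xi> k \<omega> \<in> As ! k} = (\<integral>x. markov_fd \<pi> dens As x \<partial>\<pi>))"

definition invariant :: "'a measure \<Rightarrow> ('a \<Rightarrow> 'a \<Rightarrow> real) \<Rightarrow> bool" where
  "invariant \<pi> dens \<longleftrightarrow> (\<forall>A \<in> sets \<pi>. (\<integral>w. trans_op \<pi> dens (indicator A) w \<partial>\<pi>) = measure \<pi> A)"

definition ergodic :: "'a measure \<Rightarrow> ('a \<Rightarrow> 'a \<Rightarrow> real) \<Rightarrow> bool" where
  "ergodic \<pi> dens \<longleftrightarrow> (\<forall>A \<in> sets \<pi>.
     (AE w in \<pi>. trans_op \<pi> dens (indicator A) w = indicator A w) \<longrightarrow>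
     measure \<pi> A = 0 \<or> measure \<pi> A = 1)"

text \<open>Spectral gap: sup { ||P f||_{L2} : ||f||_{L2} = 1, integral f = 0 } < 1, written as
  the existence of gamma < 1 with ||P f|| \<le> gamma ||f|| for all mean-zero f in L2(pi).\<close>
definition spectral_gap :: "'a measure \<Rightarrow> ('a \<Rightarrow> 'a \<Rightarrow> real) \<Rightarrow> bool" where
  "spectral_gap \<pi> dens \<longleftrightarrow> (\<exists>\<gamma>. 0 \<le> \<gamma> \<and> \<gamma> < 1 \<and>
     (\<forall>f. f \<in> borel_measurable \<pi> \<longrightarrow> integrable \<pi> (\<lambda>x. (f x)\<^sup>2) \<longrightarrow> (\<integral>x. f x \<partial>\<pi>) = 0 \<longrightarrow>
        integrable \<pi> (\<lambda>x. (trans_op \<pi> dens f x)\<^sup>2) \<and>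
        sqrt (\<integral>x. (trans_op \<pi> dens f x)\<^sup>2 \<partial>\<pi>) \<le> \<gamma> * sqrt (\<integral>x. (f x)\<^sup>2 \<partial>\<pi>)))"

text \<open>c_*(lambda) = c_minus for lambda < 0, c_plus for lambda > 0 (value at 0 irrelevant).\<close>
definition cstar :: "real \<Rightarrow> real \<Rightarrow> real \<Rightarrow> real" where
  "cstar cp cm x = (if x < 0 then cm else cp)"

definition levy_exponent :: "real \<Rightarrow> real \<Rightarrow> real \<Rightarrow> real \<Rightarrow> complex" where
  "levy_exponent \<alpha> cp cm p = complex_of_real \<alpha> *
     (\<integral>x. (1 + \<i> * complex_of_real (x * p) - cis (x * p)) *
           complex_of_real (cstar cp cm x / (\<bar>x\<bar> powr (1 + \<alpha>))) \<partial>lborel)"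

definition Zproc :: "real \<Rightarrow> ('a \<Rightarrow> real) \<Rightarrow> (nat \<Rightarrow> 'w \<Rightarrow> 'a) \<Rightarrow> nat \<Rightarrow> real \<Rightarrow> 'w \<Rightarrow> real" where
  "Zproc \<alpha> \<Psi> \<xi> N t \<omega> = real N powr (- 1 / \<alpha>) * (\<Sum>n = 0..nat \<lfloor>real N * t\<rfloor>. \<Psi> (\<xi> n \<omega>))"

end

(*
  Write g = cis (h * Psi) with h = p N^(-1/alpha), let P be the transition operator and put
  u 0 = 1, u (n+1) = P (g * u n), m n = pi (u n), r n = u n - m n.  The Markov property identifies
  E cis (p Z) with m (k+1), where k is the index of the last summand of Z, and

    r (n+1) = m n * (P - pi) (g - 1) + (P - pi) (g * r n),    m (n+1) = pi g * m n + pi ((g - 1) * r n).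

  As |g| = 1, the spectral gap makes the first recursion contract in L2, where the bounded density
  makes the forcing term O(|h|); one further step, bounded from L1 to Linf, upgrades r n = O(|h|) to
  the sup norm.  Hence each step of the second recursion costs O(h^2), and m n = (pi g)^n + O(n h^2)
  without any perturbation theory of the spectrum.

  For a single factor, Fubini writes the integral of cis (h x) - 1 - i h x against any measure
  in terms of its two tails.  Both pi g and the Levy exponent are of this form, and the tail
  condition compares them: pi g = exp (- psi h) + O(|h|^(alpha + alpha1)).  Since
  psi h = psi p / N, raising to the power k+1 and replacing (k+1)/N by t yields the bound
  already with the rate N^(-alpha1/alpha) alone.
*)

theory Submission
  imports Defs
begin

section \<open>Characteristic functions and tails\<close>

text \<open>The estimates are shaped by the infinite variance of \<Psi>. The tail of |\<Psi>| is of
  order s^(-alpha) with alpha < 2, so g - 1 is only of order |h|^(alpha/2) in L2, while it is O(|h|)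
  in L1 because \<Psi> is integrable. Pairing it with r n by Cauchy-Schwarz would cost |h|^(1 +
  alpha/2) per step, too much once alpha1 > 1 - alpha/2. Hence g - 1 is always measured in L1, its
  partner r n has to be measured in the sup norm, and L2 serves only for the contraction. The
  exponents have a common source: the integral of |cis s - 1| s^(-b) over s > 0 converges exactly
  for 1 < b < 2. It is used with b = alpha for the tails and with b = alpha + alpha1 for their
  deviation from pure powers. For h = p N^(-1/alpha) a loss of |h|^(alpha + alpha1) in each of about
  N t steps gives N^(-alpha1/alpha), and h^2 is no larger than this loss when |h| <= 1.\<close>

lemma norm_cis_diff_1_le: "cmod (cis x - 1) \<le> \<bar>x\<bar>"
  using iexp_approx1[of x 0] by (simp add: cis_conv_exp)

lemma norm_cis_diff_1_le_2: "cmod (cis x - 1) \<le> 2"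
  using norm_triangle_ineq4[of "cis x" 1] by simp

lemma norm_cis_diff_1_abs: "cmod (cis \<bar>x\<bar> - 1) = cmod (cis x - 1)"
proof -
  have "cmod (cis (- y) - 1) = cmod (cis y - 1)" for y
    by (metis cis_cnj complex_cnj_diff complex_cnj_one complex_mod_cnj)
  then show ?thesis by (metis abs_if)
qed

text \<open>Near 0 the factor |cis s - 1| <= s gains one power, so b < 2 suffices there; far out it
  is at most 2, and b > 1 gives convergence.\<close>

lemma integrable_norm_cis_powr:
  assumes "1 < b" "b < 2"
  shows "integrable lborel (\<lambda>s. indicator {0<..} s * (cmod (cis s - 1) * s powr (- b)))"
proof (rule Bochner_Integration.integrable_bound)
  \<comment> \<open>The power integrals are obtained for Lebesgue measure;
    \<open>integrable_completion\<close> carries them over to \<open>lborel\<close>.\<close>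
  have "set_integrable lebesgue {0..1} (\<lambda>s::real. s powr (1 - b))"
    using assms by (intro nonnegative_absolutely_integrable_1 integrable_on_powr_from_0) auto
  then have 1: "integrable lborel (\<lambda>s::real. indicator {0..1} s *\<^sub>R (s powr (1 - b)))"
    unfolding set_integrable_def by (subst (asm) integrable_completion) auto
  have "set_integrable lebesgue {1..} (\<lambda>s::real. s powr (- b))"
    using assms has_integral_powr_to_inf[of "-b" 1]
    by (intro nonnegative_absolutely_integrable_1) (auto simp: integrable_on_def)
  then have 2: "integrable lborel (\<lambda>s::real. indicator {1..} s *\<^sub>R (s powr (- b)))"
    unfolding set_integrable_def by (subst (asm) integrable_completion) auto
  show "integrable lborel (\<lambda>s::real. indicator {0..1} s *\<^sub>R (s powr (1 - b))
      + 2 * (indicator {1..} s *\<^sub>R (s powr (- b))))"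
    by (intro Bochner_Integration.integrable_add integrable_mult_right 1 2)
  have "indicator {0<..} s * (cmod (cis s - 1) * s powr (- b))
      \<le> indicator {0..1} s *\<^sub>R (s powr (1 - b)) + 2 * (indicator {1..} s *\<^sub>R (s powr (- b)))" for s :: real
  proof (cases "0 < s \<and> s < 1")
    case True
    then have "cmod (cis s - 1) * s powr (- b) \<le> s * s powr (- b)"
      using norm_cis_diff_1_le[of s] by (intro mult_right_mono) auto
    also have "\<dots> = s powr (1 - b)"
      using True by (simp add: powr_diff powr_minus divide_inverse)
    finally show ?thesis using True by (simp add: indicator_def)
  next
    case False
    then show ?thesis
      using mult_right_mono[OF norm_cis_diff_1_le_2[of s], of "s powr (-b)"]
      by (cases "s \<le> 0") (auto simp: indicator_def add_increasing)
  qed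
  then show "AE s in lborel. norm (indicator {0<..} s * (cmod (cis s - 1) * s powr (- b)))
     \<le> norm (indicator {0..1} s *\<^sub>R (s powr (1 - b)) + 2 * (indicator {1..} s *\<^sub>R (s powr (- b))))"
    by (intro AE_I2) (smt (verit) real_norm_def indicator_pos_le mult_nonneg_nonneg norm_ge_zero powr_ge_zero)
qed (auto simp: cis_conv_exp)

text \<open>Substitute |h| s for s; the sign of h is lost because conjugation preserves |cis x - 1|.
  The exponent b - 1 becomes b in \<open>tail_transform_bound\<close>, where differentiating the
  remainder contributes one more factor h.\<close>

lemma norm_cis_powr_scale:
  assumes "1 < b" "b < 2" "h \<noteq> 0"
  defines "J \<equiv> LINT s|lborel. indicator {0<..} s * (cmod (cis s - 1) * s powr (- b))"
  shows "integrable lborel (\<lambda>s. indicator {0<..} s * (cmod (cis (h * s) - 1) * s powr (- b)))" (is "integrable _ ?f")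
    and "(LINT s|lborel. indicator {0<..} s * (cmod (cis (h * s) - 1) * s powr (- b))) = \<bar>h\<bar> powr (b - 1) * J"
proof -
  let ?q = "\<lambda>s. indicator {0<..} s * (cmod (cis s - 1) * s powr (- b))"
  \<comment> \<open>The summand 0 brings the argument into the form \<open>t + c * x\<close> of the
    affine substitution rules.\<close>
  have eq: "?q (0 + \<bar>h\<bar> * s) = \<bar>h\<bar> powr (- b) * ?f s" for s
  proof (cases "0 < s")
    case True
    then have "\<bar>h\<bar> * s = \<bar>h * s\<bar>" by (simp add: abs_mult)
    then have "cmod (cis (\<bar>h\<bar> * s) - 1) = cmod (cis (h * s) - 1)"
      using norm_cis_diff_1_abs[of "h * s"] by simp
    with True assms show ?thesis
      by (simp add: indicator_def powr_mult)
  qed (use assms in \<open>auto simp: indicator_def zero_less_mult_iff\<close>)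
  have cancel: "\<bar>h\<bar> powr b * (\<bar>h\<bar> powr (- b) * y) = y" for y :: real
    using assms(3) by (simp add: powr_minus mult.assoc[symmetric])
  have "integrable lborel (\<lambda>s. ?q (0 + \<bar>h\<bar> * s))"
    using integrable_norm_cis_powr[OF assms(1,2)] assms(3) by (subst lborel_integrable_real_affine_iff) auto
  then have "integrable lborel (\<lambda>s. \<bar>h\<bar> powr b * (\<bar>h\<bar> powr (- b) * ?f s))"
    unfolding eq by (rule integrable_mult_right)
  then show "integrable lborel ?f" unfolding cancel .
  have "J = \<bar>h\<bar> * (LINT s|lborel. ?q (0 + \<bar>h\<bar> * s))"
    unfolding J_def using lborel_integral_real_affine[of "\<bar>h\<bar>" ?q 0] assms(3) by simp
  also have "\<dots> = \<bar>h\<bar> powr 1 * (\<bar>h\<bar> powr (- b) * (LINT s|lborel. ?f s))"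
    unfolding eq using assms(3) by simp
  finally show "(LINT s|lborel. ?f s) = \<bar>h\<bar> powr (b - 1) * J"
    using assms(3) by (simp add: powr_diff powr_minus field_simps)
qed

section \<open>Layer-cake formula for the compensated exponential\<close>

text \<open>The compensated integrand of the Levy-Khinchine formula. Under a law with mean zero its
  expectation is the characteristic function minus 1.\<close>

definition cis_rem :: "real \<Rightarrow> real \<Rightarrow> complex" where
  "cis_rem h x = cis (h * x) - 1 - \<i> * complex_of_real (h * x)"

lemma cis_rem_0 [simp]: "cis_rem h 0 = 0"
  by (simp add: cis_rem_def)

lemma measurable_cis [measurable]: "cis \<in> borel_measurable borel"
  unfolding cis_conv_exp by measurable

lemma measurable_cis_rem [measurable]: "cis_rem h \<in> borel_measurable borel"
  unfolding cis_rem_def by measurable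

text \<open>The integrand is the derivative of \<open>cis_rem h\<close>, which vanishes at 0. The
  range of integration is put into an \<open>if\<close> so that s and y can later be treated as two
  variables of one kernel.\<close>

lemma integral_cis_rem_ramp:
  "(LINT s|lborel. (if 0 < s \<and> s < y then \<i> * of_real h * (cis (h * s) - 1) else 0)) = cis_rem h (max 0 y)"
proof (cases "0 < y")
  case True
  \<comment> \<open>Strict tails lead to an open interval and the fundamental theorem of calculus to
    a closed one; they differ in two points.\<close>
  have "(LINT s|lborel. (if 0 < s \<and> s < y then \<i> * of_real h * (cis (h * s) - 1) else 0))
      = (LINT s|lborel. indicator {0..y} s *\<^sub>R (\<i> * of_real h * (cis (h * s) - 1)))"
  proof (rule integral_cong_AE)
    show "AE s in lborel. (if 0 < s \<and> s < y then \<i> * of_real h * (cis (h * s) - 1) else 0)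
        = indicator {0..y} s *\<^sub>R (\<i> * of_real h * (cis (h * s) - 1))"
      using AE_lborel_singleton[of 0] AE_lborel_singleton[of y]
      by eventually_elim (auto simp: indicator_def)
  qed measurable
  also have "\<dots> = cis_rem h y - cis_rem h 0"
  proof (rule integral_FTC_Icc)
    show "(cis_rem h has_vector_derivative \<i> * of_real h * (cis (h * s) - 1)) (at s within {0..y})" for s
      unfolding cis_rem_def cis_conv_exp
      by (auto intro!: derivative_eq_intros has_vector_derivative_real_field simp: algebra_simps)
    show "continuous_on {0..y} (\<lambda>s. \<i> * of_real h * (cis (h * s) - 1))"
      by (intro continuous_intros)
  qed (use True in auto)
  finally show ?thesis using True by simp
next
  case False
  then have "(if 0 < s \<and> s < y then \<i> * of_real h * (cis (h * s) - 1) else 0) = 0" for s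
    by auto
  then show ?thesis using False by (simp add: max_def)
qed

text \<open>Fubini applied to \<open>integral_cis_rem_ramp\<close>. The measure is only sigma-finite
  because the Levy measure can have infinite mass near 0; for the same reason finiteness is asked of
  the tails beyond s > 0 alone.\<close>

lemma layer_cake_cis_rem:
  fixes X :: "'b \<Rightarrow> real"
  assumes "sigma_finite_measure \<mu>" and X [measurable]: "X \<in> borel_measurable \<mu>"
    and fin: "\<And>s. 0 < s \<Longrightarrow> emeasure \<mu> {x \<in> space \<mu>. s < X x} < \<infinity>"
    and int: "integrable lborel (\<lambda>s. indicator {0<..} s * (cmod (cis (h * s) - 1) * measure \<mu> {x \<in> space \<mu>. s < X x}))"
  shows "integrable \<mu> (\<lambda>x. cis_rem h (max 0 (X x)))"
    and "(LINT x|\<mu>. cis_rem h (max 0 (X x)))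
      = \<i> * of_real h * (LINT s|lborel. indicator {0<..} s *\<^sub>R ((cis (h * s) - 1) * of_real (measure \<mu> {x \<in> space \<mu>. s < X x})))"
proof -
  interpret sigma_finite_measure \<mu> by fact
  interpret P: pair_sigma_finite lborel \<mu> by standard
  \<comment> \<open>Integrating this kernel in s gives the remainder at the positive part of
    \<open>X x\<close>; integrating it in x gives a multiple of the tail beyond s.\<close>
  let ?k = "\<lambda>s x. if 0 < s \<and> s < X x then \<i> * of_real h * (cis (h * s) - 1) else 0 :: complex"
  have k_eq: "?k s x = of_real (indicator {x \<in> space \<mu>. s < X x} x) * (indicator {0<..} s *\<^sub>R (\<i> * of_real h * (cis (h * s) - 1)))"
    if "x \<in> space \<mu>" for s x using that by (auto simp: indicator_def)
  have nk_eq: "cmod (?k s x) = indicator {x \<in> space \<mu>. s < X x} x * (indicator {0<..} s * (\<bar>h\<bar> * cmod (cis (h * s) - 1)))"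
    if "x \<in> space \<mu>" for s x using that by (simp add: indicator_def norm_mult)
  have m [measurable]: "case_prod ?k \<in> borel_measurable (lborel \<Otimes>\<^sub>M \<mu>)"
    by measurable
  have ik: "integrable \<mu> (?k s)" for s
  proof (cases "0 < s")
    case True
    have "integrable \<mu> (\<lambda>x. complex_of_real (indicator {x \<in> space \<mu>. s < X x} x) * (indicator {0<..} s *\<^sub>R (\<i> * of_real h * (cis (h * s) - 1))))"
      using fin[OF True] by (intro integrable_mult_left integrable_of_real) (auto intro!: integrable_real_indicator)
    then show ?thesis by (subst Bochner_Integration.integrable_cong[OF refl k_eq]) auto
  qed auto
  have i: "integrable (lborel \<Otimes>\<^sub>M \<mu>) (case_prod ?k)"
  proof (rule P.Fubini_integrable[OF m])
    have A: "{x \<in> space \<mu>. s < X x} \<inter> space \<mu> = {x \<in> space \<mu>. s < X x}" for s by auto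
    have "(LINT x|\<mu>. cmod (?k s x)) = \<bar>h\<bar> * (indicator {0<..} s * (cmod (cis (h * s) - 1) * measure \<mu> {x \<in> space \<mu>. s < X x}))" for s
      by (subst Bochner_Integration.integral_cong[OF refl nk_eq]) (auto simp: A)
    then show "integrable lborel (\<lambda>s. LINT x|\<mu>. cmod (case_prod ?k (s, x)))"
      using int by simp
  qed (use ik in auto)
  have "integrable \<mu> (\<lambda>x. LINT s|lborel. ?k s x)"
    using P.integrable_snd[OF i] by simp
  then show "integrable \<mu> (\<lambda>x. cis_rem h (max 0 (X x)))"
    unfolding integral_cis_rem_ramp .
  have "(LINT x|\<mu>. cis_rem h (max 0 (X x))) = (LINT s|lborel. LINT x|\<mu>. ?k s x)"
    using P.Fubini_integral[OF i] unfolding integral_cis_rem_ramp .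
  also have "\<dots> = (LINT s|lborel. \<i> * of_real h * (indicator {0<..} s *\<^sub>R ((cis (h * s) - 1) * of_real (measure \<mu> {x \<in> space \<mu>. s < X x}))))"
  proof (rule Bochner_Integration.integral_cong[OF refl])
    fix s
    have A: "{x \<in> space \<mu>. s < X x} \<inter> space \<mu> = {x \<in> space \<mu>. s < X x}" by auto
    have "(LINT x|\<mu>. ?k s x) = (LINT x|\<mu>. complex_of_real (indicator {x \<in> space \<mu>. s < X x} x)) * (indicator {0<..} s *\<^sub>R (\<i> * of_real h * (cis (h * s) - 1)))"
      by (subst Bochner_Integration.integral_cong[OF refl k_eq]) auto
    then show "(LINT x|\<mu>. ?k s x) = \<i> * of_real h * (indicator {0<..} s *\<^sub>R ((cis (h * s) - 1) * of_real (measure \<mu> {x \<in> space \<mu>. s < X x})))"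
      by (simp add: A mult_ac)
  qed
  also have "\<dots> = \<i> * of_real h * (LINT s|lborel. indicator {0<..} s *\<^sub>R ((cis (h * s) - 1) * of_real (measure \<mu> {x \<in> space \<mu>. s < X x})))"
    by (rule integral_mult_right_zero)
  finally show "(LINT x|\<mu>. cis_rem h (max 0 (X x)))
      = \<i> * of_real h * (LINT s|lborel. indicator {0<..} s *\<^sub>R ((cis (h * s) - 1) * of_real (measure \<mu> {x \<in> space \<mu>. s < X x})))" .
qed

text \<open>The negative part enters with frequency -h, since \<open>cis_rem h (- y)\<close> equals
  \<open>cis_rem (- h) y\<close>; the inactive half is \<open>cis_rem _ 0\<close>.\<close>

lemma cis_rem_split: "cis_rem h x = cis_rem h (max 0 x) + cis_rem (- h) (max 0 (- x))"
  by (cases "0 \<le> x") (auto simp: max_def cis_rem_def)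

text \<open>The tail is a parameter integral of a jointly measurable function. Monotonicity is no
  shortcut: \<open>measure\<close> is 0 on a set of infinite mass, so for the Levy measure the
  real-valued tail need not be monotone across s = 0.\<close>

lemma borel_measurable_upper_tail:
  assumes "sigma_finite_measure \<mu>" and [measurable]: "X \<in> borel_measurable \<mu>"
  shows "(\<lambda>s::real. measure \<mu> {x \<in> space \<mu>. s < X x}) \<in> borel_measurable borel"
proof -
  interpret sigma_finite_measure \<mu> by fact
  have "measure \<mu> {x \<in> space \<mu>. s < X x} = enn2real (\<integral>\<^sup>+x. (if s < X x then 1 else 0) \<partial>\<mu>)" for s
  proof -
    have "(\<integral>\<^sup>+x. (if s < X x then 1 else 0) \<partial>\<mu>) = (\<integral>\<^sup>+x. indicator {x \<in> space \<mu>. s < X x} x \<partial>\<mu>)"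
      by (intro nn_integral_cong) (auto simp: indicator_def)
    then show ?thesis by (simp add: measure_def)
  qed
  then show ?thesis by simp
qed

section \<open>Characteristic functions as linear functionals of the tails\<close>

text \<open>The right-hand side of the layer-cake formula as a functional of the tail T. Its
  linearity turns a comparison of tails into a comparison of characteristic functions.\<close>

definition tail_transform :: "real \<Rightarrow> (real \<Rightarrow> real) \<Rightarrow> complex" where
  "tail_transform h T = \<i> * of_real h * (LINT s|lborel. indicator {0<..} s *\<^sub>R ((cis (h * s) - 1) * of_real (T s)))"

definition tail_const :: "real \<Rightarrow> real" where
  "tail_const b = (LINT s|lborel. indicator {0<..} s * (cmod (cis s - 1) * s powr (- b)))"

lemma tail_const_nonneg: "0 \<le> tail_const b"
  unfolding tail_const_def by (intro Bochner_Integration.integral_nonneg) auto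

text \<open>Domination by a pure power, followed by scaling: the outer factor |h| meets |h|^(b -
  1).\<close>

lemma tail_transform_bound:
  assumes b: "1 < b" "b < 2" and [measurable]: "T \<in> borel_measurable borel"
    and T: "\<And>s. 0 < s \<Longrightarrow> \<bar>T s\<bar> \<le> D * s powr (- b)"
  shows "integrable lborel (\<lambda>s. indicator {0<..} s *\<^sub>R ((cis (h * s) - 1) * of_real (T s)))"
    and "cmod (tail_transform h T) \<le> D * tail_const b * \<bar>h\<bar> powr b"
proof -
  let ?g = "\<lambda>s. D * (indicator {0<..} s * (cmod (cis (h * s) - 1) * s powr (- b)))"
  let ?f = "\<lambda>s. indicator {0<..} s *\<^sub>R ((cis (h * s) - 1) * complex_of_real (T s))"
  have g: "integrable lborel ?g"
    using norm_cis_powr_scale(1)[OF b] by (cases "h = 0") auto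
  have fg: "cmod (?f s) \<le> ?g s" for s
    using mult_left_mono[OF T[of s], of "cmod (cis (h * s) - 1)"]
    by (auto simp: indicator_def norm_mult mult_ac)
  then have fg': "cmod (?f s) \<le> norm (?g s)" for s
    using fg[of s] norm_ge_zero[of "?f s"] by (smt (verit) real_norm_def)
  show f: "integrable lborel ?f"
    by (rule Bochner_Integration.integrable_bound[OF g]) (use fg' in auto)
  have "cmod (LINT s|lborel. ?f s) \<le> (LINT s|lborel. ?g s)"
    by (rule Bochner_Integration.integral_norm_bound_integral[OF f g fg])
  then have "cmod (tail_transform h T) \<le> \<bar>h\<bar> * (LINT s|lborel. ?g s)"
    unfolding tail_transform_def by (simp add: norm_mult mult_left_mono)
  also have "\<dots> = D * tail_const b * \<bar>h\<bar> powr b"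
  proof (cases "h = 0")
    case False
    have "\<bar>h\<bar> * (LINT s|lborel. ?g s) = \<bar>h\<bar> powr 1 * (D * (\<bar>h\<bar> powr (b - 1) * tail_const b))"
      using False norm_cis_powr_scale(2)[OF b False] by (simp add: tail_const_def)
    also have "\<dots> = (\<bar>h\<bar> powr 1 * \<bar>h\<bar> powr (b - 1)) * D * tail_const b" by (simp add: mult_ac)
    also have "\<dots> = D * tail_const b * \<bar>h\<bar> powr b" unfolding powr_add[symmetric] by simp
    finally show ?thesis .
  qed auto
  finally show "cmod (tail_transform h T) \<le> D * tail_const b * \<bar>h\<bar> powr b" .
qed

lemma tail_transform_diff:
  assumes b: "1 < b" "b < 2" and [measurable]: "S \<in> borel_measurable borel" "T \<in> borel_measurable borel"
    and S: "\<And>s. 0 < s \<Longrightarrow> \<bar>S s\<bar> \<le> C * s powr (- b)"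
    and T: "\<And>s. 0 < s \<Longrightarrow> \<bar>T s\<bar> \<le> D * s powr (- b)"
  shows "tail_transform h S - tail_transform h T = tail_transform h (\<lambda>s. S s - T s)"
proof -
  let ?f = "\<lambda>T s. indicator {0<..} s *\<^sub>R ((cis (h * s) - 1) * complex_of_real (T s))"
  have "(LINT s|lborel. ?f (\<lambda>s. S s - T s) s) = (LINT s|lborel. ?f S s - ?f T s)"
    by (intro Bochner_Integration.integral_cong) (auto simp: algebra_simps)
  also have "\<dots> = (LINT s|lborel. ?f S s) - (LINT s|lborel. ?f T s)"
    by (intro Bochner_Integration.integral_diff tail_transform_bound(1)[OF b _ S] tail_transform_bound(1)[OF b _ T]) auto
  finally show ?thesis unfolding tail_transform_def by (simp add: right_diff_distrib)
qed

text \<open>Applied twice: to \<Psi> under \<open>\<pi>\<close>, and to the identity under the Levy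
  measure, so that both sides of the comparison become tail transforms.\<close>

lemma integral_cis_rem_eq_tail_transform:
  fixes X :: "'b \<Rightarrow> real"
  assumes sf: "sigma_finite_measure \<mu>" and X [measurable]: "X \<in> borel_measurable \<mu>"
    and b: "1 < b" "b < 2"
    and fin: "\<And>s. 0 < s \<Longrightarrow> emeasure \<mu> {x \<in> space \<mu>. s < X x} < \<infinity>"
      "\<And>s. 0 < s \<Longrightarrow> emeasure \<mu> {x \<in> space \<mu>. X x < - s} < \<infinity>"
    and tail: "\<And>s. 0 < s \<Longrightarrow> measure \<mu> {x \<in> space \<mu>. s < X x} \<le> C * s powr (- b)"
      "\<And>s. 0 < s \<Longrightarrow> measure \<mu> {x \<in> space \<mu>. X x < - s} \<le> C * s powr (- b)"
  shows "integrable \<mu> (\<lambda>x. cis_rem h (X x))"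
    and "(LINT x|\<mu>. cis_rem h (X x)) = tail_transform h (\<lambda>s. measure \<mu> {x \<in> space \<mu>. s < X x})
      + tail_transform (- h) (\<lambda>s. measure \<mu> {x \<in> space \<mu>. X x < - s})"
proof -
  have neg: "s < - X x \<longleftrightarrow> X x < - s" for s x by auto
  have int: "integrable lborel (\<lambda>s. indicator {0<..} s * (cmod (cis (h * s) - 1) * T s))"
    if T: "\<And>s. 0 \<le> T s" "\<And>s. 0 < s \<Longrightarrow> T s \<le> C * s powr (- b)" "T \<in> borel_measurable borel" for h T
  proof -
    have "integrable lborel (\<lambda>s. indicator {0<..} s *\<^sub>R ((cis (h * s) - 1) * complex_of_real (T s)))"
      using T by (intro tail_transform_bound(1)[OF b, where D=C]) auto
    then have "integrable lborel (\<lambda>s. cmod (indicator {0<..} s *\<^sub>R ((cis (h * s) - 1) * complex_of_real (T s))))"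
      by (rule integrable_norm)
    then show ?thesis using T(1) by (simp add: norm_mult)
  qed
  have X': "(\<lambda>x. - X x) \<in> borel_measurable \<mu>" by measurable
  note m' = borel_measurable_upper_tail[OF sf X', unfolded neg]
  have p: "integrable \<mu> (\<lambda>x. cis_rem h (max 0 (X x)))"
    "(LINT x|\<mu>. cis_rem h (max 0 (X x))) = tail_transform h (\<lambda>s. measure \<mu> {x \<in> space \<mu>. s < X x})"
    unfolding tail_transform_def
    by (rule layer_cake_cis_rem[OF sf X fin(1) int];
        use tail(1) borel_measurable_upper_tail[OF sf X] in simp)+
  have m: "integrable \<mu> (\<lambda>x. cis_rem (- h) (max 0 (- X x)))"
    "(LINT x|\<mu>. cis_rem (- h) (max 0 (- X x))) = tail_transform (- h) (\<lambda>s. measure \<mu> {x \<in> space \<mu>. X x < - s})"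
    unfolding tail_transform_def
    by (rule layer_cake_cis_rem[OF sf X', unfolded neg, OF fin(2) int];
        use tail(2) m' in simp)+
  show "integrable \<mu> (\<lambda>x. cis_rem h (X x))"
    by (subst cis_rem_split) (intro Bochner_Integration.integrable_add p(1) m(1))
  show "(LINT x|\<mu>. cis_rem h (X x)) = tail_transform h (\<lambda>s. measure \<mu> {x \<in> space \<mu>. s < X x})
      + tail_transform (- h) (\<lambda>s. measure \<mu> {x \<in> space \<mu>. X x < - s})"
    unfolding p(2)[symmetric] m(2)[symmetric]
    by (subst cis_rem_split) (rule Bochner_Integration.integral_add[OF p(1) m(1)])
qed

section \<open>The Levy exponent\<close>

text \<open>The factor \<open>\<alpha>\<close> stands in front of the integral in
  \<open>levy_exponent\<close>; inside the density it makes the tails exactly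
  \<open>cp * s powr (- \<alpha>)\<close> and \<open>cm * s powr (- \<alpha>)\<close>.\<close>

definition levy_density :: "real \<Rightarrow> real \<Rightarrow> real \<Rightarrow> real \<Rightarrow> real" where
  "levy_density \<alpha> cp cm x = \<alpha> * (cstar cp cm x / \<bar>x\<bar> powr (1 + \<alpha>))"

definition levy_measure :: "real \<Rightarrow> real \<Rightarrow> real \<Rightarrow> real measure" where
  "levy_measure \<alpha> cp cm = density lborel (\<lambda>x. ennreal (levy_density \<alpha> cp cm x))"

lemma measurable_levy_density [measurable]: "levy_density \<alpha> cp cm \<in> borel_measurable borel"
  unfolding levy_density_def cstar_def by measurable

lemma nn_integral_power_tail:
  assumes "0 < \<alpha>" "0 \<le> c" "0 < s"
  shows "(\<integral>\<^sup>+x. ennreal (\<alpha> * (c / \<bar>x\<bar> powr (1 + \<alpha>))) * indicator {s<..} x \<partial>lborel) = ennreal (c * s powr (- \<alpha>))"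
proof -
  have "(\<integral>\<^sup>+x. ennreal (\<alpha> * (c / \<bar>x\<bar> powr (1 + \<alpha>))) * indicator {s<..} x \<partial>lborel)
      = (\<integral>\<^sup>+x. ennreal (\<alpha> * (c / \<bar>x\<bar> powr (1 + \<alpha>))) * indicator {s..} x \<partial>lborel)"
    by (intro nn_integral_cong_AE) (use AE_lborel_singleton[of s] in \<open>eventually_elim; auto simp: indicator_def\<close>)
  also have "\<dots> = 0 - (- c * s powr (- \<alpha>))"
  proof (rule nn_integral_FTC_atLeast)
    show "DERIV (\<lambda>x. - c * x powr (- \<alpha>)) x :> \<alpha> * (c / \<bar>x\<bar> powr (1 + \<alpha>))" if "s \<le> x" for x
    proof -
      have e: "x powr (- \<alpha> - 1) = 1 / \<bar>x\<bar> powr (1 + \<alpha>)"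
      proof -
        have "- \<alpha> - 1 = - (1 + \<alpha>)" by simp
        then show ?thesis using that assms by (simp only: powr_minus) (simp add: divide_inverse)
      qed
      show ?thesis
        using that assms by (auto intro!: derivative_eq_intros simp: e)
    qed
    have "((\<lambda>x. - c * x powr (- \<alpha>)) \<longlongrightarrow> - c * 0) at_top"
      using assms by (intro tendsto_mult tendsto_const tendsto_neg_powr filterlim_ident) auto
    then show "((\<lambda>x. - c * x powr (- \<alpha>)) \<longlongrightarrow> 0) at_top" by simp
  qed (use assms in auto)
  finally show ?thesis by simp
qed

text \<open>These pure powers are the model tails of the tail condition. The left tail is reduced to
  the right one by reflection.\<close>

lemma emeasure_levy_measure:
  assumes "0 < \<alpha>" "0 \<le> cp" "0 \<le> cm" "0 < s"
  shows "emeasure (levy_measure \<alpha> cp cm) {x. s < x} = ennreal (cp * s powr (- \<alpha>))"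
    and "emeasure (levy_measure \<alpha> cp cm) {x. x < - s} = ennreal (cm * s powr (- \<alpha>))"
proof -
  have "emeasure (levy_measure \<alpha> cp cm) {x. s < x} = (\<integral>\<^sup>+x. ennreal (levy_density \<alpha> cp cm x) * indicator {x. s < x} x \<partial>lborel)"
    unfolding levy_measure_def by (rule emeasure_density) auto
  also have "\<dots> = (\<integral>\<^sup>+x. ennreal (\<alpha> * (cp / \<bar>x\<bar> powr (1 + \<alpha>))) * indicator {s<..} x \<partial>lborel)"
    using assms by (intro nn_integral_cong) (auto simp: indicator_def levy_density_def cstar_def)
  finally show "emeasure (levy_measure \<alpha> cp cm) {x. s < x} = ennreal (cp * s powr (- \<alpha>))"
    using nn_integral_power_tail assms by simp
  have "emeasure (levy_measure \<alpha> cp cm) {x. x < - s} = (\<integral>\<^sup>+x. ennreal (levy_density \<alpha> cp cm x) * indicator {x. x < - s} x \<partial>lborel)"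
    unfolding levy_measure_def by (rule emeasure_density) auto
  also have "\<dots> = (\<integral>\<^sup>+x. ennreal (levy_density \<alpha> cp cm (0 + -1 * x)) * indicator {x. x < - s} (0 + -1 * x) \<partial>lborel)"
    by (subst nn_integral_real_affine[where c="-1" and t=0]) auto
  also have "\<dots> = (\<integral>\<^sup>+x. ennreal (\<alpha> * (cm / \<bar>x\<bar> powr (1 + \<alpha>))) * indicator {s<..} x \<partial>lborel)"
    using assms by (intro nn_integral_cong) (auto simp: indicator_def levy_density_def cstar_def)
  finally show "emeasure (levy_measure \<alpha> cp cm) {x. x < - s} = ennreal (cm * s powr (- \<alpha>))"
    using nn_integral_power_tail assms by simp
qed

lemma sigma_finite_levy_measure: "sigma_finite_measure (levy_measure \<alpha> cp cm)"
  unfolding levy_measure_def by (subst sigma_finite_measure.sigma_finite_iff_density_finite[OF sigma_finite_lborel]) auto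

lemma levy_density_nonneg: "0 < \<alpha> \<Longrightarrow> 0 \<le> cp \<Longrightarrow> 0 \<le> cm \<Longrightarrow> 0 \<le> levy_density \<alpha> cp cm x"
  by (auto simp: levy_density_def cstar_def)

lemma levy_exponent_eq:
  assumes "0 < \<alpha>" "0 \<le> cp" "0 \<le> cm"
  shows "levy_exponent \<alpha> cp cm p = - (LINT x|levy_measure \<alpha> cp cm. cis_rem p x)"
proof -
  have "(LINT x|levy_measure \<alpha> cp cm. cis_rem p x) = (LINT x|lborel. levy_density \<alpha> cp cm x *\<^sub>R cis_rem p x)"
    unfolding levy_measure_def using levy_density_nonneg[OF assms] by (intro integral_density) auto
  also have "\<dots> = (LINT x|lborel. - of_real \<alpha> * ((1 + \<i> * complex_of_real (x * p) - cis (x * p)) *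
           complex_of_real (cstar cp cm x / (\<bar>x\<bar> powr (1 + \<alpha>)))))"
  proof -
    have "(\<alpha> * w) *\<^sub>R cis_rem p x = - of_real \<alpha> * ((1 + \<i> * complex_of_real (x * p) - cis (x * p)) * complex_of_real w)" for x w
      by (simp add: cis_rem_def scaleR_conv_of_real algebra_simps)
    then show ?thesis unfolding levy_density_def by (intro Bochner_Integration.integral_cong refl)
  qed
  also have "\<dots> = - levy_exponent \<alpha> cp cm p"
    unfolding levy_exponent_def by (subst integral_mult_right_zero) simp
  finally show ?thesis by simp
qed

text \<open>Substituting c x for x gives c from the Jacobian and c^(-1-alpha) from the density,
  while \<open>cstar\<close> sees only the sign of x. This self-similarity fixes the normalisation
  N^(-1/alpha).\<close>

lemma levy_exponent_scale:
  assumes "0 < c"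
  shows "levy_exponent \<alpha> cp cm (c * p) = of_real (c powr \<alpha>) * levy_exponent \<alpha> cp cm p"
proof -
  let ?f = "\<lambda>p x. (1 + \<i> * complex_of_real (x * p) - cis (x * p)) *
           complex_of_real (cstar cp cm x / (\<bar>x\<bar> powr (1 + \<alpha>)))"
  have "?f p (0 + c * x) = of_real (c powr - (1 + \<alpha>)) * ?f (c * p) x" for x
  proof -
    have "cstar cp cm (c * x) / (\<bar>c * x\<bar> powr (1 + \<alpha>)) = c powr - (1 + \<alpha>) * (cstar cp cm x / (\<bar>x\<bar> powr (1 + \<alpha>)))"
      unfolding powr_minus
      using assms by (auto simp: cstar_def abs_mult powr_mult divide_simps zero_less_mult_iff mult_less_0_iff)
    then show ?thesis by (simp add: mult_ac)
  qed
  then have "(LINT x|lborel. ?f p x) = c *\<^sub>R (LINT x|lborel. of_real (c powr - (1 + \<alpha>)) * ?f (c * p) x)"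
    using lborel_integral_real_affine[of c "?f p" 0] assms by simp
  also have "\<dots> = of_real (c powr 1 * c powr - (1 + \<alpha>)) * (LINT x|lborel. ?f (c * p) x)"
    using assms by (subst integral_mult_right_zero) (simp add: scaleR_conv_of_real)
  also have "c powr 1 * c powr - (1 + \<alpha>) = c powr (- \<alpha>)"
    unfolding powr_add[symmetric] by simp
  finally have "of_real (c powr \<alpha>) * (LINT x|lborel. ?f p x) = of_real (c powr \<alpha> * c powr (- \<alpha>)) * (LINT x|lborel. ?f (c * p) x)"
    by simp
  also have "c powr \<alpha> * c powr (- \<alpha>) = 1"
    unfolding powr_add[symmetric] using assms by simp
  finally show ?thesis unfolding levy_exponent_def by (simp add: mult_ac)
qed

lemma levy_cis_rem:
  assumes a: "1 < \<alpha>" "\<alpha> < 2" and c: "0 \<le> cp" "0 \<le> cm"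
  shows "integrable (levy_measure \<alpha> cp cm) (cis_rem p)"
    and "- levy_exponent \<alpha> cp cm p = tail_transform p (\<lambda>s. cp * s powr (- \<alpha>)) + tail_transform (- p) (\<lambda>s. cm * s powr (- \<alpha>))"
proof -
  let ?\<nu> = "levy_measure \<alpha> cp cm"
  have sp: "space ?\<nu> = UNIV" by (simp add: levy_measure_def)
  have ms: "(\<lambda>x. x) \<in> borel_measurable ?\<nu>" unfolding levy_measure_def by simp
  have m: "0 < s \<Longrightarrow> measure ?\<nu> {x. s < x} = cp * s powr (- \<alpha>)" "0 < s \<Longrightarrow> measure ?\<nu> {x. x < - s} = cm * s powr (- \<alpha>)" for s
    using emeasure_levy_measure[of \<alpha> cp cm s] a c by (auto simp: measure_def)
  have "0 < s \<Longrightarrow> measure ?\<nu> {x. s < x} \<le> (cp + cm) * s powr (- \<alpha>)" "0 < s \<Longrightarrow> measure ?\<nu> {x. x < - s} \<le> (cp + cm) * s powr (- \<alpha>)" for s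
    using m c by (auto intro!: mult_right_mono)
  note I = integral_cis_rem_eq_tail_transform[OF sigma_finite_levy_measure ms a, unfolded sp, simplified, OF _ _ this, of p]
  have E: "0 < s \<Longrightarrow> emeasure ?\<nu> {x. s < x} < top" "0 < s \<Longrightarrow> emeasure ?\<nu> {x. x < - s} < top" for s
    using emeasure_levy_measure[of \<alpha> cp cm s] a c by auto
  show "integrable ?\<nu> (cis_rem p)" using I(1) E by simp
  \<comment> \<open>The tails of the Levy measure are known as powers only for s > 0, and the
    transform looks at T only there.\<close>
  have cong: "tail_transform h S = tail_transform h T" if "\<And>s. 0 < s \<Longrightarrow> S s = T s" for h S T
    unfolding tail_transform_def
    by (intro arg_cong2[where f="(*)"] refl Bochner_Integration.integral_cong) (auto simp: indicator_def that)
  have "- levy_exponent \<alpha> cp cm p = tail_transform p (\<lambda>s. measure ?\<nu> {x. s < x}) + tail_transform (- p) (\<lambda>s. measure ?\<nu> {x. x < - s})"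
    using I(2) E levy_exponent_eq[of \<alpha> cp cm p] a c by simp
  also have "\<dots> = tail_transform p (\<lambda>s. cp * s powr (- \<alpha>)) + tail_transform (- p) (\<lambda>s. cm * s powr (- \<alpha>))"
    using m by (intro arg_cong2[where f="(+)"] cong)
  finally show "- levy_exponent \<alpha> cp cm p = tail_transform p (\<lambda>s. cp * s powr (- \<alpha>)) + tail_transform (- p) (\<lambda>s. cm * s powr (- \<alpha>))" .
qed

lemma levy_exponent_bound:
  assumes a: "1 < \<alpha>" "\<alpha> < 2" and c: "0 \<le> cp" "0 \<le> cm"
  shows "cmod (levy_exponent \<alpha> cp cm p) \<le> (cp + cm) * tail_const \<alpha> * \<bar>p\<bar> powr \<alpha>"
proof -
  have "cmod (tail_transform p (\<lambda>s. cp * s powr (- \<alpha>))) \<le> cp * tail_const \<alpha> * \<bar>p\<bar> powr \<alpha>"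
    using c by (intro tail_transform_bound(2)[OF a]) auto
  moreover have "cmod (tail_transform (- p) (\<lambda>s. cm * s powr (- \<alpha>))) \<le> cm * tail_const \<alpha> * \<bar>- p\<bar> powr \<alpha>"
    using c by (intro tail_transform_bound(2)[OF a]) auto
  ultimately have "cmod (- levy_exponent \<alpha> cp cm p) \<le> (cp + cm) * tail_const \<alpha> * \<bar>p\<bar> powr \<alpha>"
    unfolding levy_cis_rem(2)[OF a c] by (intro norm_triangle_le) (simp add: algebra_simps)
  then show ?thesis by simp
qed

text \<open>The real part of \<open>cis_rem p x\<close> is cos (p x) - 1 <= 0. Hence |exp (- psi)|
  <= 1, and -psi lies in the half-plane where the next two lemmas apply.\<close>

lemma Re_levy_exponent_nonneg:
  assumes a: "1 < \<alpha>" "\<alpha> < 2" and c: "0 \<le> cp" "0 \<le> cm"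
  shows "0 \<le> Re (levy_exponent \<alpha> cp cm p)"
proof -
  have "Re (levy_exponent \<alpha> cp cm p) = - (LINT x|levy_measure \<alpha> cp cm. Re (cis_rem p x))"
    using levy_exponent_eq[of \<alpha> cp cm p] levy_cis_rem(1)[OF a c, of p] a c by (simp add: integral_Re)
  also have "\<dots> = (LINT x|levy_measure \<alpha> cp cm. - Re (cis_rem p x))" by simp
  also have "\<dots> \<ge> 0"
    by (intro Bochner_Integration.integral_nonneg) (simp add: cis_rem_def)
  finally show ?thesis .
qed

section \<open>The exponential on the left half-plane\<close>

text \<open>The half-plane is convex and the derivative of \<open>exp\<close> has modulus at most 1
  on it.\<close>

lemma exp_lipschitz_Re_nonpos:
  assumes "Re z \<le> 0" "Re w \<le> 0"
  shows "cmod (exp z - exp w) \<le> cmod (z - w)"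
proof -
  have "cmod (exp z - exp w) \<le> 1 * cmod (z - w)"
  proof (rule field_differentiable_bound[where S="{z. Re z \<le> 0}"])
    show "convex {z. Re z \<le> 0}" by (rule convex_halfspace_Re_le)
    show "(exp has_field_derivative exp z) (at z within {z. Re z \<le> 0})" for z
      by (rule DERIV_subset[OF DERIV_exp]) auto
  qed (use assms in auto)
  then show ?thesis by simp
qed

text \<open>The same mean value argument on a half-disc of radius \<open>cmod z\<close>, where the
  derivative \<open>exp w - 1\<close> is at most \<open>cmod z\<close> by the previous
  lemma.\<close>

lemma exp_minus_1_quadratic:
  assumes "Re z \<le> 0"
  shows "cmod (exp z - (1 + z)) \<le> (cmod z)\<^sup>2"
proof -
  let ?S = "{w. Re w \<le> 0} \<inter> cball 0 (cmod z)"
  have "cmod ((exp z - (1 + z)) - (exp 0 - (1 + 0))) \<le> cmod z * cmod (z - 0)"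
  proof (rule field_differentiable_bound[where S="?S"])
    show "convex ?S" by (intro convex_Int convex_halfspace_Re_le convex_cball)
    show "((\<lambda>w. exp w - (1 + w)) has_field_derivative exp w - 1) (at w within ?S)" for w
      by (auto intro!: derivative_eq_intros)
    show "cmod (exp w - 1) \<le> cmod z" if "w \<in> ?S" for w
      using exp_lipschitz_Re_nonpos[of w 0] that by auto
  qed (use assms in auto)
  then show ?thesis by (simp add: power2_eq_square)
qed

section \<open>The characteristic function of a single summand\<close>

text \<open>For |h| <= 1 the difference between pi g and 1 - psi is a tail transform of the
  deviations, of order |h|^b; passing from 1 - psi to exp (- psi) costs |psi|^2 = O(|h|^(2 alpha)),
  and 2 alpha > 2 > b. For |h| > 1 both numbers lie in the unit disc.\<close>

lemma (in prob_space) norm_char_minus_exp_levy_le: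
  fixes \<Psi> :: "'a \<Rightarrow> real"
  assumes Psi_meas [measurable]: "\<Psi> \<in> borel_measurable M"
    and Psi_int: "integrable M \<Psi>" "(\<integral>x. \<Psi> x \<partial>M) = 0"
    and alpha: "1 < \<alpha>" "\<alpha> < 2"
    and alpha1: "0 < \<alpha>1" "\<alpha>1 < 2 - \<alpha>"
    and cpm: "0 \<le> cp" "0 \<le> cm"
    and Cstar: "0 < Cstar"
    and tails: "\<And>s. 1 \<le> s \<Longrightarrow>
       \<bar>measure M {x \<in> space M. \<Psi> x > s} - cp / s powr \<alpha>\<bar>
       + \<bar>measure M {x \<in> space M. \<Psi> x < - s} - cm / s powr \<alpha>\<bar>
       \<le> Cstar / s powr (\<alpha> + \<alpha>1)"
  obtains K where "0 \<le> K"
    "\<And>h. cmod ((\<integral>x. cis (h * \<Psi> x) \<partial>M) - exp (- levy_exponent \<alpha> cp cm h)) \<le> K * \<bar>h\<bar> powr (\<alpha> + \<alpha>1)"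
proof -
  define b where "b = \<alpha> + \<alpha>1"
  have b: "1 < b" "b < 2" using alpha alpha1 by (auto simp: b_def)
  define Tp where "Tp s = measure M {x \<in> space M. s < \<Psi> x}" for s
  define Tm where "Tm s = measure M {x \<in> space M. \<Psi> x < - s}" for s
  define D where "D = 1 + cp + cm + Cstar"
  have neg: "s < - \<Psi> x \<longleftrightarrow> \<Psi> x < - s" for s x by auto
  have [measurable]: "Tp \<in> borel_measurable borel"
    unfolding Tp_def using borel_measurable_upper_tail[OF sigma_finite_measure_axioms Psi_meas] .
  have Psi_meas': "(\<lambda>x. - \<Psi> x) \<in> borel_measurable M" by measurable
  have [measurable]: "Tm \<in> borel_measurable borel"
    unfolding Tm_def using borel_measurable_upper_tail[OF sigma_finite_measure_axioms Psi_meas', unfolded neg] .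
  have T01: "0 \<le> Tp s" "0 \<le> Tm s" "Tp s \<le> 1" "Tm s \<le> 1" for s by (auto simp: Tp_def Tm_def)
  txt \<open>For \<open>s < 1\<close> the tail condition gives nothing, but there \<open>s powr (- b)\<close> dominates both terms, so that
    the comparison of tails holds on the whole half-line with one constant.\<close>
  have near: "\<bar>T - c * s powr (- \<alpha>)\<bar> \<le> D * s powr (- b)" if "0 < s" "s < 1" "0 \<le> T" "T \<le> 1" "0 \<le> c" "c \<le> cp + cm" for s T c
  proof -
    have "1 = s powr 0" using that by simp
    also have "\<dots> \<le> s powr (- b)" using that b by (intro powr_mono') auto
    finally have "T \<le> s powr (- b)" using that by simp
    moreover have "c * s powr (- \<alpha>) \<le> c * s powr (- b)"
      using that alpha1 by (intro mult_left_mono powr_mono') (auto simp: b_def)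
    ultimately have "\<bar>T - c * s powr (- \<alpha>)\<bar> \<le> (1 + c) * s powr (- b)"
      using that by (auto simp: abs_le_iff algebra_simps) (smt (verit) mult_nonneg_nonneg powr_ge_zero)+
    also have "\<dots> \<le> D * s powr (- b)" using that Cstar by (intro mult_right_mono) (auto simp: D_def)
    finally show ?thesis .
  qed
  have far: "\<bar>Tp s - cp * s powr (- \<alpha>)\<bar> \<le> D * s powr (- b)" "\<bar>Tm s - cm * s powr (- \<alpha>)\<bar> \<le> D * s powr (- b)" if "1 \<le> s" for s
  proof -
    have e: "cp / s powr \<alpha> = cp * s powr (- \<alpha>)" "cm / s powr \<alpha> = cm * s powr (- \<alpha>)" "Cstar / s powr (\<alpha> + \<alpha>1) = Cstar * s powr (- b)"
      unfolding b_def powr_minus by (auto simp: divide_inverse)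
    have "Cstar * s powr (- b) \<le> D * s powr (- b)" using cpm by (intro mult_right_mono) (auto simp: D_def)
    then show "\<bar>Tp s - cp * s powr (- \<alpha>)\<bar> \<le> D * s powr (- b)" "\<bar>Tm s - cm * s powr (- \<alpha>)\<bar> \<le> D * s powr (- b)"
      using tails[OF that] unfolding e Tp_def[symmetric] Tm_def[symmetric] by auto
  qed
  have dp: "\<bar>Tp s - cp * s powr (- \<alpha>)\<bar> \<le> D * s powr (- b)" and dm: "\<bar>Tm s - cm * s powr (- \<alpha>)\<bar> \<le> D * s powr (- b)" if "0 < s" for s
    using far[of s] near[of s "Tp s" cp] near[of s "Tm s" cm] T01 cpm that by (cases "1 \<le> s"; auto)+
  \<comment> \<open>Fubini needs a bound on the tails themselves, which decay only with exponent
    alpha. For s >= 1 the deviation is absorbed because b > alpha; for s < 1 it is enough that T <=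
    1.\<close>
  have up: "T \<le> (cp + cm + D) * s powr (- \<alpha>)" if "0 < s" "\<bar>T - c * s powr (- \<alpha>)\<bar> \<le> D * s powr (- b)" "0 \<le> T" "T \<le> 1" "0 \<le> c" "c \<le> cp + cm" for s T c
  proof (cases "1 \<le> s")
    case True
    have "D * s powr (- b) \<le> D * s powr (- \<alpha>)"
      using True cpm Cstar alpha1 by (intro mult_left_mono powr_mono) (auto simp: D_def b_def)
    then have "T \<le> (c + D) * s powr (- \<alpha>)" using that by (auto simp: algebra_simps abs_le_iff)
    also have "\<dots> \<le> (cp + cm + D) * s powr (- \<alpha>)" using that by (intro mult_right_mono) auto
    finally show ?thesis .
  next
    case False
    have "1 = s powr 0" using that by simp
    also have "\<dots> \<le> s powr (- \<alpha>)" using that False alpha by (intro powr_mono') auto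
    also have "\<dots> \<le> (cp + cm + D) * s powr (- \<alpha>)"
      using mult_right_mono[of 1 "cp + cm + D" "s powr (- \<alpha>)"] cpm Cstar by (auto simp: D_def)
    finally show ?thesis using that by simp
  qed
  have upp: "Tp s \<le> (cp + cm + D) * s powr (- \<alpha>)" and upm: "Tm s \<le> (cp + cm + D) * s powr (- \<alpha>)" if "0 < s" for s
    using up[OF that dp[OF that]] up[OF that dm[OF that]] T01 cpm by auto
  note I = integral_cis_rem_eq_tail_transform[OF sigma_finite_measure_axioms Psi_meas alpha _ _
      upp[unfolded Tp_def] upm[unfolded Tm_def], folded Tp_def Tm_def, simplified emeasure_eq_measure, simplified]
  have main: "cmod ((\<integral>x. cis (h * \<Psi> x) \<partial>M) - 1 + levy_exponent \<alpha> cp cm h) \<le> 2 * D * tail_const b * \<bar>h\<bar> powr b" for h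
  proof -
    have icis: "integrable M (\<lambda>x. cis (h * \<Psi> x))"
      by (rule integrable_const_bound[where B=1]) auto
    \<comment> \<open>As \<Psi> has mean zero, the linear term of the remainder integrates to
      0.\<close>
    have "(\<integral>x. cis_rem h (\<Psi> x) \<partial>M) = (\<integral>x. cis (h * \<Psi> x) \<partial>M) - 1"
      unfolding cis_rem_def using icis Psi_int by (simp add: prob_space)
    then have "(\<integral>x. cis (h * \<Psi> x) \<partial>M) - 1 + levy_exponent \<alpha> cp cm h
      = (tail_transform h Tp - tail_transform h (\<lambda>s. cp * s powr (- \<alpha>))) + (tail_transform (- h) Tm - tail_transform (- h) (\<lambda>s. cm * s powr (- \<alpha>)))"
      using I(2)[of h] levy_cis_rem(2)[OF alpha cpm, of h, symmetric] by (simp add: algebra_simps eq_neg_iff_add_eq_0[symmetric])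
    also have "\<dots> = tail_transform h (\<lambda>s. Tp s - cp * s powr (- \<alpha>)) + tail_transform (- h) (\<lambda>s. Tm s - cm * s powr (- \<alpha>))"
      using upp upm T01 cpm by (intro arg_cong2[where f="(+)"] tail_transform_diff[OF alpha]) auto
    also have "cmod \<dots> \<le> D * tail_const b * \<bar>h\<bar> powr b + D * tail_const b * \<bar>- h\<bar> powr b"
      by (intro norm_triangle_le add_mono tail_transform_bound(2)[OF b] dp dm) auto
    finally show ?thesis by simp
  qed
  define L where "L = (cp + cm) * tail_const \<alpha>"
  \<comment> \<open>The 2 covers |h| > 1; the other summands are the deviation of the two tails and
    the quadratic error of the exponential.\<close>
  define K where "K = 2 + 2 * D * tail_const b + L\<^sup>2"
  have D0: "0 \<le> D" using cpm Cstar by (auto simp: D_def)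
  show ?thesis
  proof
    show "0 \<le> K" using D0 tail_const_nonneg[of b] by (auto simp: K_def)
    fix h
    let ?\<psi> = "levy_exponent \<alpha> cp cm h" and ?g = "\<integral>x. cis (h * \<Psi> x) \<partial>M"
    have re: "0 \<le> Re ?\<psi>" by (rule Re_levy_exponent_nonneg[OF alpha cpm])
    show "cmod (?g - exp (- ?\<psi>)) \<le> K * \<bar>h\<bar> powr (\<alpha> + \<alpha>1)"
    proof (cases "\<bar>h\<bar> \<le> 1")
      case True
      have "(cmod ?\<psi>)\<^sup>2 \<le> (L * \<bar>h\<bar> powr \<alpha>)\<^sup>2"
        using levy_exponent_bound[OF alpha cpm, of h] by (intro power_mono) (auto simp: L_def)
      also have "\<dots> = L\<^sup>2 * (\<bar>h\<bar> powr \<alpha>)\<^sup>2" by (simp add: power_mult_distrib)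
      also have "(\<bar>h\<bar> powr \<alpha>)\<^sup>2 = \<bar>h\<bar> powr (\<alpha> + \<alpha>)" unfolding powr_add by (rule power2_eq_square)
      also have "L\<^sup>2 * \<bar>h\<bar> powr (\<alpha> + \<alpha>) \<le> L\<^sup>2 * \<bar>h\<bar> powr b"
        using True b alpha alpha1 by (intro mult_left_mono powr_mono') (auto simp: b_def)
      finally have 1: "(cmod ?\<psi>)\<^sup>2 \<le> L\<^sup>2 * \<bar>h\<bar> powr b" .
      have "?g - exp (- ?\<psi>) = (?g - 1 + ?\<psi>) - (exp (- ?\<psi>) - (1 + - ?\<psi>))" by simp
      also have "cmod \<dots> \<le> cmod (?g - 1 + ?\<psi>) + cmod (exp (- ?\<psi>) - (1 + - ?\<psi>))"
        by (rule norm_triangle_ineq4)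
      also have "\<dots> \<le> 2 * D * tail_const b * \<bar>h\<bar> powr b + L\<^sup>2 * \<bar>h\<bar> powr b"
        using exp_minus_1_quadratic[of "- ?\<psi>"] re 1 main[of h] by simp
      also have "\<dots> \<le> K * \<bar>h\<bar> powr b" by (simp add: K_def algebra_simps)
      finally show ?thesis by (simp add: b_def)
    next
      case False
      have "cmod ?g \<le> 1"
        using integral_norm_bound[of M "\<lambda>x. cis (h * \<Psi> x)"] by (simp add: prob_space)
      moreover have "cmod (exp (- ?\<psi>)) \<le> 1" using re by simp
      ultimately have "cmod (?g - exp (- ?\<psi>)) \<le> 2"
        using norm_triangle_ineq4[of ?g "exp (- ?\<psi>)"] by linarith
      also have "\<dots> \<le> K * 1" using D0 tail_const_nonneg[of b] by (simp add: K_def)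
      also have "\<dots> \<le> K * \<bar>h\<bar> powr (\<alpha> + \<alpha>1)"
        using False alpha alpha1 \<open>0 \<le> K\<close> by (intro mult_left_mono ge_one_powr_ge_zero) auto
      finally show ?thesis .
    qed
  qed
qed

section \<open>Markov operators with a density\<close>

lemma integral_tendsto_bounded:
  fixes F :: "nat \<Rightarrow> 'b \<Rightarrow> complex"
  assumes "prob_space N" "\<And>i. F i \<in> borel_measurable N" "\<And>i x. x \<in> space N \<Longrightarrow> cmod (F i x) \<le> c"
    "\<And>x. x \<in> space N \<Longrightarrow> (\<lambda>i. F i x) \<longlonglongrightarrow> f x"
  shows "(\<lambda>i. \<integral>x. F i x \<partial>N) \<longlonglongrightarrow> (\<integral>x. f x \<partial>N)"
proof -
  interpret N: prob_space N by fact
  show ?thesis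
    by (rule integral_dominated_convergence[where w="\<lambda>_. c"])
      (auto intro!: borel_measurable_LIMSEQ_metric[OF assms(2,4)] assms(2-4) AE_I2)
qed

text \<open>Young's inequality with a weight: y keeps a factor close to 1, so a contraction acting
  on y survives squaring.\<close>

lemma norm_add_sq_le:
  fixes p y :: complex
  assumes "0 < \<eta>"
  shows "(cmod (p + y))\<^sup>2 \<le> (1 + 1 / \<eta>) * (cmod p)\<^sup>2 + (1 + \<eta>) * (cmod y)\<^sup>2"
proof -
  have "(cmod (p + y))\<^sup>2 \<le> (cmod p + cmod y)\<^sup>2"
    by (intro power_mono norm_triangle_ineq norm_ge_zero)
  also have "\<dots> = (cmod p)\<^sup>2 + (cmod y)\<^sup>2 + 2 * cmod p * cmod y" by (rule power2_sum)
  also have "2 * cmod p * cmod y \<le> (cmod p)\<^sup>2 / \<eta> + \<eta> * (cmod y)\<^sup>2"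
  proof -
    have "0 \<le> (cmod p - \<eta> * cmod y)\<^sup>2 / \<eta>" using assms by simp
    also have "\<dots> = (cmod p)\<^sup>2 / \<eta> + \<eta> * (cmod y)\<^sup>2 - 2 * cmod p * cmod y"
      using assms by (simp add: power2_diff power2_eq_square field_simps)
    finally show ?thesis by simp
  qed
  finally show ?thesis by (simp add: algebra_simps)
qed

text \<open>\<open>dens w\<close> is a probability density for every w, so that the operator
  preserves pointwise bounds. The L-infinity bound holds only almost everywhere and enters
  separately.\<close>

locale markov_density = prob_space \<pi> for \<pi> :: "'a measure" +
  fixes dens :: "'a \<Rightarrow> 'a \<Rightarrow> real"
  assumes space_UNIV: "space \<pi> = UNIV"
    and dens_measurable [measurable]: "(\<lambda>z. dens (fst z) (snd z)) \<in> borel_measurable (\<pi> \<Otimes>\<^sub>M \<pi>)"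
    and dens_nonneg: "\<And>w. AE v in \<pi>. 0 \<le> dens w v"
    and dens_int: "\<And>w. integrable \<pi> (dens w)" "\<And>w. (\<integral>v. dens w v \<partial>\<pi>) = 1"
begin

section \<open>Bounded measurable functions and the transition operator\<close>

text \<open>The bound holds everywhere, not almost everywhere, because these functions are evaluated
  along paths. The class is stable under products and \<open>Pop\<close>, which makes integrability
  automatic.\<close>

definition bmeas :: "('a \<Rightarrow> complex) set" where
  "bmeas = {f. f \<in> borel_measurable \<pi> \<and> (\<exists>c. \<forall>x. cmod (f x) \<le> c)}"

definition Pop :: "('a \<Rightarrow> complex) \<Rightarrow> 'a \<Rightarrow> complex" where
  "Pop f w = (\<integral>v. of_real (dens w v) * f v \<partial>\<pi>)"

lemma bmeasI: "f \<in> borel_measurable \<pi> \<Longrightarrow> (\<And>x. cmod (f x) \<le> c) \<Longrightarrow> f \<in> bmeas"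
  unfolding bmeas_def by auto

lemma bmeas_measurable [measurable_dest]: "f \<in> bmeas \<Longrightarrow> f \<in> borel_measurable \<pi>"
  unfolding bmeas_def by auto

lemma bmeas_bound:
  assumes "f \<in> bmeas" obtains c where "0 \<le> c" "\<And>x. cmod (f x) \<le> c"
  using assms unfolding bmeas_def by (auto intro: order_trans[OF norm_ge_zero])

lemma bmeas_integrable: "f \<in> bmeas \<Longrightarrow> integrable \<pi> f"
  by (metis bmeas_bound bmeas_measurable integrable_const_bound AE_I2)

lemma bmeas_const [simp]: "(\<lambda>_. c) \<in> bmeas"
  by (rule bmeasI) auto

lemma bmeas_add: "f \<in> bmeas \<Longrightarrow> g \<in> bmeas \<Longrightarrow> (\<lambda>x. f x + g x) \<in> bmeas"
proof -
  assume f: "f \<in> bmeas" and g: "g \<in> bmeas"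
  obtain c d where "\<And>x. cmod (f x) \<le> c" "\<And>x. cmod (g x) \<le> d"
    using f g by (metis bmeas_bound)
  then show ?thesis using f g by (intro bmeasI[of _ "c + d"]) (auto intro: norm_triangle_mono dest: bmeas_measurable)
qed

lemma bmeas_mult: "f \<in> bmeas \<Longrightarrow> g \<in> bmeas \<Longrightarrow> (\<lambda>x. f x * g x) \<in> bmeas"
proof -
  assume f: "f \<in> bmeas" and g: "g \<in> bmeas"
  obtain c d where "0 \<le> c" "\<And>x. cmod (f x) \<le> c" "\<And>x. cmod (g x) \<le> d"
    using f g by (metis bmeas_bound)
  then show ?thesis using f g
    by (intro bmeasI[of _ "c * d"]) (auto intro!: mult_mono simp: norm_mult dest: bmeas_measurable)
qed

lemma bmeas_diff: "f \<in> bmeas \<Longrightarrow> g \<in> bmeas \<Longrightarrow> (\<lambda>x. f x - g x) \<in> bmeas"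
  using bmeas_add[of f "\<lambda>x. (- 1) * g x"] bmeas_mult[of "\<lambda>_. - 1" g] by simp

lemma bmeas_indicator: "A \<in> sets \<pi> \<Longrightarrow> (\<lambda>x. of_real (indicator A x)) \<in> bmeas"
  by (rule bmeasI[of _ 1]) (auto simp: indicator_def)

lemma dens_measurable' [measurable]: "dens w \<in> borel_measurable \<pi>"
  using dens_int(1) by auto

lemma Pop_integrable:
  assumes "f \<in> bmeas" shows "integrable \<pi> (\<lambda>v. of_real (dens w v) * f v)"
proof -
  obtain c where c: "0 \<le> c" "\<And>x. cmod (f x) \<le> c" using assms by (rule bmeas_bound) auto
  show ?thesis
  proof (rule Bochner_Integration.integrable_bound)
    show "integrable \<pi> (\<lambda>v. c * dens w v)" using dens_int(1) by simp
    show "AE v in \<pi>. norm (complex_of_real (dens w v) * f v) \<le> norm (c * dens w v)"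
      using c by (intro AE_I2) (auto simp: norm_mult abs_mult mult.commute intro!: mult_right_mono)
  qed (use assms in measurable)
qed

lemma Pop_norm_le:
  assumes "f \<in> borel_measurable \<pi>" "\<And>x. cmod (f x) \<le> c" shows "cmod (Pop f w) \<le> c"
proof -
  have f: "f \<in> bmeas" using assms by (rule bmeasI)
  have "cmod (Pop f w) \<le> (\<integral>v. cmod (of_real (dens w v) * f v) \<partial>\<pi>)"
    unfolding Pop_def by (rule integral_norm_bound)
  also have "\<dots> \<le> (\<integral>v. c * dens w v \<partial>\<pi>)"
  proof (rule integral_mono_AE)
    show "AE v in \<pi>. cmod (of_real (dens w v) * f v) \<le> c * dens w v"
      using dens_nonneg[of w] by eventually_elim (use assms in \<open>auto simp: norm_mult mult.commute intro!: mult_right_mono\<close>)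
  qed (use Pop_integrable[OF f] dens_int(1) in auto)
  also have "\<dots> = c" using dens_int(2) by simp
  finally show ?thesis .
qed

lemma Pop_measurable [measurable]:
  assumes [measurable]: "f \<in> borel_measurable \<pi>" shows "Pop f \<in> borel_measurable \<pi>"
proof -
  have "(\<lambda>z. of_real (dens (fst z) (snd z)) * f (snd z)) \<in> borel_measurable (\<pi> \<Otimes>\<^sub>M \<pi>)" by measurable
  then have "(\<lambda>(w, v). of_real (dens w v) * f v) \<in> borel_measurable (\<pi> \<Otimes>\<^sub>M \<pi>)"
    by (simp add: case_prod_beta')
  then show ?thesis unfolding Pop_def by (rule borel_measurable_lebesgue_integral)
qed

lemma Pop_bmeas:
  assumes "f \<in> bmeas" shows "Pop f \<in> bmeas"
proof -
  obtain c where "\<And>x. cmod (f x) \<le> c" using bmeas_bound[OF assms] by blast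
  then show ?thesis
    using bmeas_measurable[OF assms] by (intro bmeasI[of _ c] Pop_norm_le Pop_measurable)
qed

lemma Pop_add: "f \<in> bmeas \<Longrightarrow> g \<in> bmeas \<Longrightarrow> Pop (\<lambda>x. f x + g x) w = Pop f w + Pop g w"
  unfolding Pop_def using Pop_integrable by (simp add: distrib_left)

lemma Pop_cmult: "Pop (\<lambda>x. a * f x) w = a * Pop f w"
  unfolding Pop_def by (simp add: mult.left_commute)

lemma Pop_const: "Pop (\<lambda>x. a) w = a"
  unfolding Pop_def using dens_int by simp

lemma Pop_tendsto:
  assumes F: "\<And>i. F i \<in> borel_measurable \<pi>" "\<And>i x. cmod (F i x) \<le> c" "\<And>x. (\<lambda>i. F i x) \<longlonglongrightarrow> f x"
  shows "(\<lambda>i. Pop (F i) w) \<longlonglongrightarrow> Pop f w"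
proof -
  have f: "f \<in> borel_measurable \<pi>" by (rule borel_measurable_LIMSEQ_metric[OF F(1) F(3)])
  show ?thesis
    unfolding Pop_def
  proof (rule integral_dominated_convergence[where w="\<lambda>v. c * \<bar>dens w v\<bar>"])
    show "(\<lambda>v. of_real (dens w v) * f v) \<in> borel_measurable \<pi>"
      using f by measurable
    show "(\<lambda>v. of_real (dens w v) * F i v) \<in> borel_measurable \<pi>" for i
      using F(1)[of i] by measurable
    show "AE v in \<pi>. (\<lambda>i. of_real (dens w v) * F i v) \<longlonglongrightarrow> of_real (dens w v) * f v"
      by (intro AE_I2 tendsto_mult tendsto_const F(3))
    show "AE v in \<pi>. norm (of_real (dens w v) * F i v) \<le> c * \<bar>dens w v\<bar>" for i
      unfolding norm_mult norm_of_real
      by (subst mult.commute) (intro AE_I2 mult_right_mono F(2) abs_ge_zero)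
    show "integrable \<pi> (\<lambda>v. c * \<bar>dens w v\<bar>)"
      by (intro integrable_mult_right integrable_abs dens_int(1))
  qed
qed

text \<open>From indicators to simple functions to uniformly bounded limits. The uniform bound in
  the limit clause is what dominated convergence asks for.\<close>

lemma bmeas_induct [consumes 1, case_names indicator add cmult lim]:
  assumes f: "f \<in> bmeas"
    and ind: "\<And>A. A \<in> sets \<pi> \<Longrightarrow> Q (\<lambda>x. of_real (indicator A x))"
    and add: "\<And>f g. f \<in> bmeas \<Longrightarrow> g \<in> bmeas \<Longrightarrow> Q f \<Longrightarrow> Q g \<Longrightarrow> Q (\<lambda>x. f x + g x)"
    and cmult: "\<And>a f. f \<in> bmeas \<Longrightarrow> Q f \<Longrightarrow> Q (\<lambda>x. a * f x)"
    and lim: "\<And>F f c. (\<And>i. F i \<in> borel_measurable \<pi>) \<Longrightarrow> (\<And>i x. cmod (F i x) \<le> c) \<Longrightarrow> (\<And>x. (\<lambda>i. F i x) \<longlonglongrightarrow> f x)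
       \<Longrightarrow> (\<And>i. Q (F i)) \<Longrightarrow> Q f"
  shows "Q f"
proof -
  have simple: "Q F" if F: "simple_function \<pi> F" for F
  proof -
    have fin: "finite (range F)" using F space_UNIV by (simp add: simple_function_def)
    have sets: "F -` {y} \<in> sets \<pi>" for y
      using simple_functionD(2)[OF F, of "{y}"] space_UNIV by simp
    have *: "(\<lambda>x. \<Sum>y\<in>S. y * of_real (indicator (F -` {y}) x)) \<in> bmeas \<and> Q (\<lambda>x. \<Sum>y\<in>S. y * of_real (indicator (F -` {y}) x))"
      if "finite S" for S
      using that
    proof (induction S)
      case empty
      show ?case using ind[OF sets.empty_sets] by simp
    next
      case (insert y S)
      have y: "(\<lambda>x. y * of_real (indicator (F -` {y}) x)) \<in> bmeas" "Q (\<lambda>x. y * of_real (indicator (F -` {y}) x))"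
        by (rule bmeas_mult[OF bmeas_const bmeas_indicator[OF sets]], rule cmult[OF bmeas_indicator[OF sets] ind[OF sets]])
      show ?case
        unfolding sum.insert[OF insert.hyps]
        using insert.IH by (intro conjI bmeas_add add y) simp_all
    qed
    have "F x = (\<Sum>y\<in>range F. y * of_real (indicator (F -` {y}) x))" for x
    proof -
      have "(\<Sum>y\<in>range F. y * of_real (indicator (F -` {y}) x)) = (\<Sum>y\<in>range F. if y = F x then y else 0)"
        by (intro sum.cong) (auto simp: indicator_def)
      then show ?thesis using fin by simp
    qed
    then have "(\<lambda>x. \<Sum>y\<in>range F. y * of_real (indicator (F -` {y}) x)) = F" by (intro ext) (rule sym)
    then show ?thesis using *[OF fin] by metis
  qed
  obtain c where c: "\<And>x. cmod (f x) \<le> c" using bmeas_bound[OF f] by blast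
  \<comment> \<open>The approximants stay within twice the modulus of f, whence the common bound
    \<open>2 * c\<close>.\<close>
  obtain F where F: "\<And>i. simple_function \<pi> (F i)" "\<And>x. (\<lambda>i. F i x) \<longlonglongrightarrow> f x" "\<And>i x. dist (F i x) 0 \<le> 2 * dist (f x) 0"
    using borel_measurable_implies_sequence_metric[OF bmeas_measurable[OF f], of 0] unfolding space_UNIV by blast
  show ?thesis
  proof (rule lim)
    show "F i \<in> borel_measurable \<pi>" for i using F(1) by (rule borel_measurable_simple_function)
    show "cmod (F i x) \<le> 2 * c" for i x
      using F(3)[of i x] c[of x] by (simp add: dist_norm)
  qed (use F simple in auto)
qed

text \<open>The complex-valued analogue of \<^const>\<open>markov_fd\<close>, with sets replaced by functions.\<close>
fun chain_fn :: "('a \<Rightarrow> complex) list \<Rightarrow> 'a \<Rightarrow> complex" where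
  "chain_fn [] = (\<lambda>x. 1)"
| "chain_fn (f # fs) = (\<lambda>x. f x * Pop (chain_fn fs) x)"

section \<open>Path expectations as iterated operators\<close>

lemma chain_fn_bmeas: "set fs \<subseteq> bmeas \<Longrightarrow> chain_fn fs \<in> bmeas"
  by (induction fs) (auto intro!: bmeas_mult Pop_bmeas)

lemma chain_fn_indicator:
  "chain_fn (map (\<lambda>A x. of_real (indicator A x)) As) = (\<lambda>x. of_real (markov_fd \<pi> dens As x))"
proof (induction As)
  case (Cons A As)
  then show ?case
    by (simp add: Pop_def) (simp only: of_real_mult[symmetric] integral_complex_of_real)
qed simp

text \<open>Writing the list as \<open>pre @ f # post\<close> isolates one slot. This lemma and the
  next two are the clauses of \<open>bmeas_induct\<close> for that slot.\<close>

lemma chain_fn_add: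
  assumes "set pre \<subseteq> bmeas" "set post \<subseteq> bmeas" "f \<in> bmeas" "g \<in> bmeas"
  shows "chain_fn (pre @ (\<lambda>x. f x + g x) # post) x = chain_fn (pre @ f # post) x + chain_fn (pre @ g # post) x"
  using assms(1)
proof (induction pre arbitrary: x)
  case Nil
  then show ?case by (simp add: distrib_right)
next
  case (Cons a pre)
  then have eq: "chain_fn (pre @ (\<lambda>x. f x + g x) # post) = (\<lambda>x. chain_fn (pre @ f # post) x + chain_fn (pre @ g # post) x)"
    by auto
  have "chain_fn (pre @ h # post) \<in> bmeas" if "h \<in> bmeas" for h
    using Cons.prems assms(2) that by (intro chain_fn_bmeas) auto
  then show ?case using assms by (simp add: eq Pop_add distrib_left)
qed

lemma chain_fn_cmult:
  "chain_fn (pre @ (\<lambda>x. a * f x) # post) x = a * chain_fn (pre @ f # post) x"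
proof (induction pre arbitrary: x)
  case (Cons b pre)
  then have "chain_fn (pre @ (\<lambda>x. a * f x) # post) = (\<lambda>x. a * chain_fn (pre @ f # post) x)" by auto
  then show ?case by (simp add: Pop_cmult mult_ac)
qed (simp add: mult_ac)

text \<open>The uniform bound is part of the claim because each further \<open>Pop\<close> needs it
  for dominated convergence.\<close>

lemma chain_fn_tendsto:
  assumes "set pre \<subseteq> bmeas" "set post \<subseteq> bmeas"
    and F: "\<And>i. F i \<in> borel_measurable \<pi>" "\<And>i x. cmod (F i x) \<le> c" "\<And>x. (\<lambda>i. F i x) \<longlonglongrightarrow> f x"
  shows "(\<exists>d. \<forall>i x. cmod (chain_fn (pre @ F i # post) x) \<le> d) \<and> (\<forall>x. (\<lambda>i. chain_fn (pre @ F i # post) x) \<longlonglongrightarrow> chain_fn (pre @ f # post) x)"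
  using assms(1)
proof (induction pre)
  case Nil
  obtain d where d: "\<And>x. cmod (Pop (chain_fn post) x) \<le> d"
    using Pop_bmeas[OF chain_fn_bmeas[OF assms(2)]] by (metis bmeas_bound)
  have "cmod (chain_fn ([] @ F i # post) x) \<le> c * d" for i x
    using mult_mono[OF F(2)[of i x] d[of x]] order_trans[OF norm_ge_zero F(2)[of i x]] by (simp add: norm_mult)
  then show ?case using F(3) by (auto intro!: tendsto_mult)
next
  case (Cons g pre)
  then obtain d where d: "\<And>i x. cmod (chain_fn (pre @ F i # post) x) \<le> d"
    and t: "\<And>x. (\<lambda>i. chain_fn (pre @ F i # post) x) \<longlonglongrightarrow> chain_fn (pre @ f # post) x" by auto
  have Fb: "F i \<in> bmeas" for i using F by (intro bmeasI)
  have m: "chain_fn (pre @ F i # post) \<in> borel_measurable \<pi>" for i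
    using Cons.prems assms Fb by (intro bmeas_measurable chain_fn_bmeas) auto
  obtain e where e: "0 \<le> e" "\<And>x. cmod (g x) \<le> e" using Cons.prems by (metis bmeas_bound list.set_intros(1) subsetD)
  have "cmod (chain_fn ((g # pre) @ F i # post) x) \<le> e * d" for i x
    using mult_mono[OF e(2)[of x] Pop_norm_le[OF m[of i] d, of x]] e by (simp add: norm_mult)
  moreover have "(\<lambda>i. chain_fn ((g # pre) @ F i # post) x) \<longlonglongrightarrow> chain_fn ((g # pre) @ f # post) x" for x
    using Pop_tendsto[OF m d t] by (auto intro!: tendsto_mult)
  ultimately show ?case by (intro conjI exI[of _ "e * d"] allI)
qed

lemma chain_expectation:
  assumes M: "prob_space M" and chain: "markov_chain M \<xi> \<pi> dens" and fs: "set fs \<subseteq> bmeas"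
  shows "(\<integral>\<omega>. (\<Prod>k<length fs. (fs ! k) (\<xi> k \<omega>)) \<partial>M) = (\<integral>x. chain_fn fs x \<partial>\<pi>)"
proof -
  interpret M: prob_space M by fact
  have xi [measurable]: "\<xi> n \<in> measurable M \<pi>" for n using chain by (auto simp: markov_chain_def)
  let ?ind = "map (\<lambda>A x. complex_of_real (indicator A x))"
  txt \<open>The assumption covers indicators only; replace them by bounded functions one at a time, from the last
    position backwards.\<close>
  define Q where "Q fs \<longleftrightarrow> (\<integral>\<omega>. (\<Prod>k<length fs. (fs ! k) (\<xi> k \<omega>)) \<partial>M) = (\<integral>x. chain_fn fs x \<partial>\<pi>)" for fs
  have meas: "(\<lambda>\<omega>. \<Prod>k<length fs. (fs ! k) (\<xi> k \<omega>)) \<in> borel_measurable M" if "set fs \<subseteq> bmeas" for fs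
  proof (rule borel_measurable_prod)
    fix k assume "k \<in> {..<length fs}"
    then have [measurable]: "fs ! k \<in> borel_measurable \<pi>" using that nth_mem by (auto intro: bmeas_measurable)
    show "(\<lambda>\<omega>. (fs ! k) (\<xi> k \<omega>)) \<in> borel_measurable M" by measurable
  qed
  have bnd: "\<exists>d. \<forall>\<omega>. cmod (\<Prod>k<length fs. (fs ! k) (\<xi> k \<omega>)) \<le> d" if "set fs \<subseteq> bmeas" for fs
  proof -
    have "\<forall>k<length fs. \<exists>c. \<forall>x. cmod ((fs ! k) x) \<le> c"
      using that nth_mem by (metis bmeas_bound subsetD)
    then obtain c where "\<And>k x. k < length fs \<Longrightarrow> cmod ((fs ! k) x) \<le> c k" by metis
    then have "cmod (\<Prod>k<length fs. (fs ! k) (\<xi> k \<omega>)) \<le> (\<Prod>k<length fs. c k)" for \<omega>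
      unfolding prod_norm[symmetric] by (intro prod_mono) auto
    then show ?thesis by blast
  qed
  have int: "integrable M (\<lambda>\<omega>. \<Prod>k<length fs. (fs ! k) (\<xi> k \<omega>))" if "set fs \<subseteq> bmeas" for fs
    using meas[OF that] bnd[OF that] by (auto intro: M.integrable_const_bound)
  \<comment> \<open>The dummy \<open>\<lambda>_. 0\<close> sits at the removed index, so the
    remaining product is literally the same term for every f.\<close>
  have split: "(\<Prod>k<length (pre @ f # post). ((pre @ f # post) ! k) (\<xi> k \<omega>))
    = f (\<xi> (length pre) \<omega>) * (\<Prod>k\<in>{..<length (pre @ f # post)} - {length pre}. ((pre @ (\<lambda>_. 0) # post) ! k) (\<xi> k \<omega>))" for pre post f \<omega>
  proof -
    have "(\<Prod>k<length (pre @ f # post). ((pre @ f # post) ! k) (\<xi> k \<omega>))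
       = f (\<xi> (length pre) \<omega>) * (\<Prod>k\<in>{..<length (pre @ f # post)} - {length pre}. ((pre @ f # post) ! k) (\<xi> k \<omega>))"
      by (subst prod.remove[of _ "length pre"]) auto
    also have "(\<Prod>k\<in>{..<length (pre @ f # post)} - {length pre}. ((pre @ f # post) ! k) (\<xi> k \<omega>))
      = (\<Prod>k\<in>{..<length (pre @ f # post)} - {length pre}. ((pre @ (\<lambda>_. 0) # post) ! k) (\<xi> k \<omega>))"
      by (intro prod.cong refl) (auto simp: nth_append nth_Cons')
    finally show ?thesis .
  qed
  have ind_b: "set (?ind As) \<subseteq> bmeas" if "set As \<subseteq> sets \<pi>" for As using that bmeas_indicator by auto
  \<comment> \<open>Sets fill a prefix of arbitrary length and functions the suffix. The induction
    shortens the suffix while the hypothesis is used with one more set at the end of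
    \<open>As\<close>.\<close>
  have "Q (?ind As @ fs)" if "set As \<subseteq> sets \<pi>" for As
    using fs that
  proof (induction fs arbitrary: As)
    case Nil
    let ?S = "{\<omega> \<in> space M. \<forall>k<length As. \<xi> k \<omega> \<in> As ! k}"
    have S: "?S = (\<Inter>k<length As. \<xi> k -` (As ! k) \<inter> space M)" if "As \<noteq> []" using that by auto
    have "?S \<in> sets M"
    proof (cases "As = []")
      case False
      have "\<xi> k -` (As ! k) \<inter> space M \<in> sets M" if "k < length As" for k
        using Nil that nth_mem by (intro measurable_sets[OF xi]) auto
      then show ?thesis unfolding S[OF False] using False by (intro sets.finite_INT) auto
    qed auto
    have "(\<Prod>k<length (?ind As). (?ind As ! k) (\<xi> k \<omega>)) = of_real (indicator ?S \<omega>)" if sp: "\<omega> \<in> space M" for \<omega>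
    proof (cases "\<omega> \<in> ?S")
      case False
      then obtain k where "k < length As" "\<xi> k \<omega> \<notin> As ! k" using sp by auto
      then have "\<exists>k\<in>{..<length (?ind As)}. (?ind As ! k) (\<xi> k \<omega>) = 0" by (intro bexI[of _ k]) auto
      then have "(\<Prod>k<length (?ind As). (?ind As ! k) (\<xi> k \<omega>)) = 0" by (simp add: prod_zero_iff)
      then show ?thesis using False by simp
    qed auto
    then have "(\<integral>\<omega>. (\<Prod>k<length (?ind As). (?ind As ! k) (\<xi> k \<omega>)) \<partial>M) = (\<integral>\<omega>. complex_of_real (indicator ?S \<omega>) \<partial>M)"
      by (intro Bochner_Integration.integral_cong refl)
    also have "\<dots> = of_real (measure M ?S)"
      unfolding integral_complex_of_real Bochner_Integration.integral_indicator
      unfolding Int_absorb2[OF Collect_restrict] ..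
    also have "\<dots> = of_real (\<integral>x. markov_fd \<pi> dens As x \<partial>\<pi>)"
      using chain Nil unfolding markov_chain_def by simp
    finally show ?case by (simp add: Q_def chain_fn_indicator)
  next
    case (Cons f fs)
    have IH: "Q (?ind As @ (\<lambda>x. complex_of_real (indicator A x)) # fs)" if "A \<in> sets \<pi>" for A
      using Cons.IH[of "As @ [A]"] Cons.prems that by simp
    have pre: "set (?ind As) \<subseteq> bmeas" and post: "set fs \<subseteq> bmeas" using ind_b Cons.prems by auto
    have full: "set (?ind As @ g # fs) \<subseteq> bmeas" if "g \<in> bmeas" for g using pre post that by auto
    have "f \<in> bmeas" using Cons.prems by simp
    then show ?case
    proof (induction f rule: bmeas_induct)
      case (indicator A)
      then show ?case by (rule IH)
    next
      case (add f g)
      have "(\<integral>\<omega>. (\<Prod>k<length (?ind As @ (\<lambda>x. f x + g x) # fs). ((?ind As @ (\<lambda>x. f x + g x) # fs) ! k) (\<xi> k \<omega>)) \<partial>M)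
        = (\<integral>\<omega>. (\<Prod>k<length (?ind As @ f # fs). ((?ind As @ f # fs) ! k) (\<xi> k \<omega>)) + (\<Prod>k<length (?ind As @ g # fs). ((?ind As @ g # fs) ! k) (\<xi> k \<omega>)) \<partial>M)"
        unfolding split by (simp add: distrib_right)
      also have "\<dots> = (\<integral>x. chain_fn (?ind As @ f # fs) x \<partial>\<pi>) + (\<integral>x. chain_fn (?ind As @ g # fs) x \<partial>\<pi>)"
        using add(3,4)[unfolded Q_def] int[OF full[OF add(1)]] int[OF full[OF add(2)]] by (subst Bochner_Integration.integral_add) auto
      also have "\<dots> = (\<integral>x. chain_fn (?ind As @ f # fs) x + chain_fn (?ind As @ g # fs) x \<partial>\<pi>)"
        using bmeas_integrable[OF chain_fn_bmeas[OF full[OF add(1)]]] bmeas_integrable[OF chain_fn_bmeas[OF full[OF add(2)]]]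
        by (rule Bochner_Integration.integral_add[symmetric])
      finally show ?case unfolding Q_def chain_fn_add[OF pre post add(1,2)] .
    next
      case (cmult a f)
      then show ?case unfolding Q_def chain_fn_cmult split by (simp add: mult.assoc)
    next
      case (lim F f c)
      have Fb: "F i \<in> bmeas" for i using lim by (intro bmeasI)
      have "(\<lambda>i. \<integral>\<omega>. (\<Prod>k<length (?ind As @ F i # fs). ((?ind As @ F i # fs) ! k) (\<xi> k \<omega>)) \<partial>M)
        \<longlonglongrightarrow> (\<integral>\<omega>. (\<Prod>k<length (?ind As @ f # fs). ((?ind As @ f # fs) ! k) (\<xi> k \<omega>)) \<partial>M)"
      proof -
        \<comment> \<open>With the constant 1 in the free slot, a bound on the whole product is a
          bound on the other factors.\<close>
        have "\<exists>d. \<forall>\<omega>. cmod (\<Prod>k<length (?ind As @ (\<lambda>_. 1) # fs). ((?ind As @ (\<lambda>_. 1) # fs) ! k) (\<xi> k \<omega>)) \<le> d"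
          by (rule bnd[OF full]) simp
        then obtain d where d: "cmod (\<Prod>k\<in>{..<length (?ind As @ (\<lambda>_. 1) # fs)} - {length (?ind As)}. ((?ind As @ (\<lambda>_. 0) # fs) ! k) (\<xi> k \<omega>)) \<le> d" for \<omega>
          unfolding split by auto
        show ?thesis
        proof (rule integral_tendsto_bounded[OF M meas[OF full[OF Fb]]])
          show "cmod (\<Prod>k<length (?ind As @ F i # fs). ((?ind As @ F i # fs) ! k) (\<xi> k \<omega>)) \<le> c * d" for i \<omega>
            unfolding split norm_mult using lim(2) d[of \<omega>] by (intro mult_mono) (auto intro: order_trans[OF norm_ge_zero])
          show "(\<lambda>i. \<Prod>k<length (?ind As @ F i # fs). ((?ind As @ F i # fs) ! k) (\<xi> k \<omega>)) \<longlonglongrightarrow> (\<Prod>k<length (?ind As @ f # fs). ((?ind As @ f # fs) ! k) (\<xi> k \<omega>))" for \<omega>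
            unfolding split using lim(3) by (auto intro!: tendsto_mult)
        qed
      qed
      moreover have "(\<lambda>i. \<integral>x. chain_fn (?ind As @ F i # fs) x \<partial>\<pi>) \<longlonglongrightarrow> (\<integral>x. chain_fn (?ind As @ f # fs) x \<partial>\<pi>)"
      proof -
        obtain d where "\<And>i x. cmod (chain_fn (?ind As @ F i # fs) x) \<le> d" "\<And>x. (\<lambda>i. chain_fn (?ind As @ F i # fs) x) \<longlonglongrightarrow> chain_fn (?ind As @ f # fs) x"
          using chain_fn_tendsto[OF pre post lim(1,2,3)] by blast
        then show ?thesis
          by (intro integral_tendsto_bounded[OF prob_space_axioms] bmeas_measurable[OF chain_fn_bmeas[OF full[OF Fb]]])
      qed
      ultimately show ?case using lim(4) unfolding Q_def by (auto intro: LIMSEQ_unique)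
    qed
  qed
  from this[of "[]"] show ?thesis by (simp add: Q_def)
qed

section \<open>Norm estimates for the transition operator\<close>

lemma bmeas_integrable_norm: "f \<in> bmeas \<Longrightarrow> integrable \<pi> (\<lambda>x. cmod (f x))"
  using bmeas_integrable by blast

lemma bmeas_integrable_norm_sq:
  assumes "f \<in> bmeas" shows "integrable \<pi> (\<lambda>x. (cmod (f x))\<^sup>2)"
proof -
  have "(\<lambda>x. f x * f x) \<in> bmeas" by (rule bmeas_mult[OF assms assms])
  from bmeas_integrable_norm[OF this] show ?thesis by (simp add: norm_mult power2_eq_square)
qed

lemma integral_norm_sq_center:
  assumes f: "f \<in> bmeas"
  shows "(\<integral>x. (cmod (f x - (\<integral>y. f y \<partial>\<pi>)))\<^sup>2 \<partial>\<pi>) = (\<integral>x. (cmod (f x))\<^sup>2 \<partial>\<pi>) - (cmod (\<integral>y. f y \<partial>\<pi>))\<^sup>2"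
proof -
  let ?c = "\<integral>y. f y \<partial>\<pi>"
  have fc: "integrable \<pi> (\<lambda>x. f x * cnj ?c)" using bmeas_integrable[OF f] by simp
  have "(cmod (f x - ?c))\<^sup>2 = (cmod (f x))\<^sup>2 - 2 * Re (f x * cnj ?c) + (cmod ?c)\<^sup>2" for x
    unfolding cmod_power2 by (simp add: power2_eq_square algebra_simps)
  then have "(\<integral>x. (cmod (f x - ?c))\<^sup>2 \<partial>\<pi>) = (\<integral>x. (cmod (f x))\<^sup>2 - 2 * Re (f x * cnj ?c) + (cmod ?c)\<^sup>2 \<partial>\<pi>)"
    by (intro Bochner_Integration.integral_cong refl)
  also have "\<dots> = (\<integral>x. (cmod (f x))\<^sup>2 \<partial>\<pi>) - 2 * (\<integral>x. Re (f x * cnj ?c) \<partial>\<pi>) + (cmod ?c)\<^sup>2"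
  proof -
    have "(\<integral>x. A x - 2 * v x + d \<partial>\<pi>) = (\<integral>x. A x \<partial>\<pi>) - 2 * (\<integral>x. v x \<partial>\<pi>) + d"
      if "integrable \<pi> A" "integrable \<pi> v" for A v and d :: real
      using that prob_space by simp
    from this[OF bmeas_integrable_norm_sq[OF f] integrable_Re[OF fc]] show ?thesis .
  qed
  also have "(\<integral>x. Re (f x * cnj ?c) \<partial>\<pi>) = Re (\<integral>x. f x * cnj ?c \<partial>\<pi>)"
    by (rule integral_Re[OF fc])
  also have "\<dots> = Re (?c * cnj ?c)" by simp
  also have "\<dots> = (cmod ?c)\<^sup>2" unfolding complex_norm_square[symmetric] by simp
  finally show ?thesis by simp
qed

lemma integral_norm_sq_center_le:
  assumes "f \<in> bmeas"
  shows "(\<integral>x. (cmod (f x - (\<integral>y. f y \<partial>\<pi>)))\<^sup>2 \<partial>\<pi>) \<le> (\<integral>x. (cmod (f x))\<^sup>2 \<partial>\<pi>)"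
  unfolding integral_norm_sq_center[OF assms] by simp

text \<open>The variance of \<open>cmod (f x)\<close> is nonnegative.\<close>

lemma integral_norm_le_sqrt:
  assumes f: "f \<in> bmeas"
  shows "(\<integral>x. cmod (f x) \<partial>\<pi>) \<le> sqrt (\<integral>x. (cmod (f x))\<^sup>2 \<partial>\<pi>)"
proof -
  obtain c where "\<And>x. cmod (f x) \<le> c" using bmeas_bound[OF f] by blast
  then have n: "(\<lambda>x. complex_of_real (cmod (f x))) \<in> bmeas"
    using bmeas_measurable[OF f] by (intro bmeasI[of _ c]) auto
  have "0 \<le> (\<integral>x. (cmod (of_real (cmod (f x)) - (\<integral>y. complex_of_real (cmod (f y)) \<partial>\<pi>)))\<^sup>2 \<partial>\<pi>)"
    by (intro Bochner_Integration.integral_nonneg) auto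
  also have "\<dots> = (\<integral>x. (cmod (f x))\<^sup>2 \<partial>\<pi>) - (\<integral>x. cmod (f x) \<partial>\<pi>)\<^sup>2"
    by (subst integral_norm_sq_center[OF n]) simp
  finally show ?thesis by (intro real_le_rsqrt) simp
qed

lemma Pop_of_real: "Pop (\<lambda>x. of_real (f x)) w = of_real (trans_op \<pi> dens f w)"
  unfolding Pop_def trans_op_def of_real_mult[symmetric] integral_complex_of_real ..

lemma Re_Pop: "f \<in> bmeas \<Longrightarrow> Re (Pop f w) = trans_op \<pi> dens (\<lambda>x. Re (f x)) w"
  and Im_Pop: "f \<in> bmeas \<Longrightarrow> Im (Pop f w) = trans_op \<pi> dens (\<lambda>x. Im (f x)) w"
  unfolding Pop_def trans_op_def
  by (simp_all add: integral_Re[OF Pop_integrable, symmetric] integral_Im[OF Pop_integrable, symmetric])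

lemma integral_Pop:
  assumes inv: "invariant \<pi> dens" and f: "f \<in> bmeas"
  shows "(\<integral>x. Pop f x \<partial>\<pi>) = (\<integral>x. f x \<partial>\<pi>)"
  using f
proof (induction f rule: bmeas_induct)
  case (indicator A)
  then show ?case using inv unfolding Pop_of_real integral_complex_of_real
    by (simp add: invariant_def space_UNIV)
next
  case (add f g)
  note [simp] = bmeas_integrable[OF add(1)] bmeas_integrable[OF add(2)] bmeas_integrable[OF Pop_bmeas[OF add(1)]] bmeas_integrable[OF Pop_bmeas[OF add(2)]]
  show ?case unfolding Pop_add[OF add(1,2)] using add(3,4) by simp
next
  case (cmult a f)
  then show ?case unfolding Pop_cmult by simp
next
  case (lim F f c)
  have "(\<lambda>i. \<integral>x. F i x \<partial>\<pi>) \<longlonglongrightarrow> (\<integral>x. f x \<partial>\<pi>)"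
    by (rule integral_tendsto_bounded[OF prob_space_axioms lim(1,2,3)])
  moreover have "(\<lambda>i. \<integral>x. Pop (F i) x \<partial>\<pi>) \<longlonglongrightarrow> (\<integral>x. Pop f x \<partial>\<pi>)"
    by (rule integral_tendsto_bounded[OF prob_space_axioms Pop_measurable[OF lim(1)] Pop_norm_le[OF lim(1,2)] Pop_tendsto[OF lim(1,2,3)]])
  ultimately show ?case unfolding lim(4) using LIMSEQ_unique by blast
qed

text \<open>The gap is stated for real functions. The density is real, so the operator acts on real
  and imaginary parts separately, and their squared norms add up.\<close>

lemma Pop_L2_contraction:
  assumes gap: "\<And>f. f \<in> borel_measurable \<pi> \<Longrightarrow> integrable \<pi> (\<lambda>x. (f x)\<^sup>2) \<Longrightarrow> (\<integral>x. f x \<partial>\<pi>) = 0 \<Longrightarrow>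
        integrable \<pi> (\<lambda>x. (trans_op \<pi> dens f x)\<^sup>2) \<and>
        sqrt (\<integral>x. (trans_op \<pi> dens f x)\<^sup>2 \<partial>\<pi>) \<le> \<gamma> * sqrt (\<integral>x. (f x)\<^sup>2 \<partial>\<pi>)"
    and f: "f \<in> bmeas" and mean: "(\<integral>x. f x \<partial>\<pi>) = 0"
  shows "(\<integral>x. (cmod (Pop f x))\<^sup>2 \<partial>\<pi>) \<le> \<gamma>\<^sup>2 * (\<integral>x. (cmod (f x))\<^sup>2 \<partial>\<pi>)"
proof -
  note [measurable] = bmeas_measurable[OF f]
  have real: "integrable \<pi> (\<lambda>x. (trans_op \<pi> dens u x)\<^sup>2)"
      "(\<integral>x. (trans_op \<pi> dens u x)\<^sup>2 \<partial>\<pi>) \<le> \<gamma>\<^sup>2 * (\<integral>x. (u x)\<^sup>2 \<partial>\<pi>)"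
    if "u \<in> borel_measurable \<pi>" "integrable \<pi> (\<lambda>x. (u x)\<^sup>2)" "(\<integral>x. u x \<partial>\<pi>) = 0" for u
  proof -
    note g = gap[OF that]
    show "integrable \<pi> (\<lambda>x. (trans_op \<pi> dens u x)\<^sup>2)" using g ..
    have "(sqrt (\<integral>x. (trans_op \<pi> dens u x)\<^sup>2 \<partial>\<pi>))\<^sup>2 \<le> (\<gamma> * sqrt (\<integral>x. (u x)\<^sup>2 \<partial>\<pi>))\<^sup>2"
      using g by (intro power_mono) auto
    then show "(\<integral>x. (trans_op \<pi> dens u x)\<^sup>2 \<partial>\<pi>) \<le> \<gamma>\<^sup>2 * (\<integral>x. (u x)\<^sup>2 \<partial>\<pi>)"
      by (simp add: power_mult_distrib)
  qed
  have iR: "integrable \<pi> (\<lambda>x. (Re (f x))\<^sup>2)" and iI: "integrable \<pi> (\<lambda>x. (Im (f x))\<^sup>2)"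
    by (rule Bochner_Integration.integrable_bound[OF bmeas_integrable_norm_sq[OF f]]; simp add: cmod_power2)+
  have "(\<integral>x. Re (f x) \<partial>\<pi>) = 0" "(\<integral>x. Im (f x) \<partial>\<pi>) = 0"
    using mean integral_Re[OF bmeas_integrable[OF f]] integral_Im[OF bmeas_integrable[OF f]] by simp_all
  note R = real[OF _ iR this(1)] and I = real[OF _ iI this(2)]
  have "(\<integral>x. (cmod (Pop f x))\<^sup>2 \<partial>\<pi>) = (\<integral>x. (trans_op \<pi> dens (\<lambda>x. Re (f x)) x)\<^sup>2 + (trans_op \<pi> dens (\<lambda>x. Im (f x)) x)\<^sup>2 \<partial>\<pi>)"
    unfolding cmod_power2 Re_Pop[OF f] Im_Pop[OF f] ..
  also have "\<dots> = (\<integral>x. (trans_op \<pi> dens (\<lambda>x. Re (f x)) x)\<^sup>2 \<partial>\<pi>) + (\<integral>x. (trans_op \<pi> dens (\<lambda>x. Im (f x)) x)\<^sup>2 \<partial>\<pi>)"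
    by (rule Bochner_Integration.integral_add) (rule R(1) I(1); measurable)+
  also have "\<dots> \<le> \<gamma>\<^sup>2 * (\<integral>x. (Re (f x))\<^sup>2 \<partial>\<pi>) + \<gamma>\<^sup>2 * (\<integral>x. (Im (f x))\<^sup>2 \<partial>\<pi>)"
    by (rule add_mono) (rule R(2) I(2); measurable)+
  also have "\<dots> = \<gamma>\<^sup>2 * (\<integral>x. (cmod (f x))\<^sup>2 \<partial>\<pi>)"
    unfolding cmod_power2 using iR iI by (simp add: distrib_left)
  finally show ?thesis .
qed

text \<open>Fubini turns the bound for almost every pair into one for almost every starting point.
  The result is used only under integrals over \<open>\<pi>\<close>.\<close>

lemma Pop_L1_Linf:
  assumes bnd: "AE z in \<pi> \<Otimes>\<^sub>M \<pi>. \<bar>dens (fst z) (snd z)\<bar> \<le> B" and f: "f \<in> bmeas"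
  shows "AE w in \<pi>. cmod (Pop f w) \<le> B * (\<integral>x. cmod (f x) \<partial>\<pi>)"
proof -
  interpret P: pair_sigma_finite \<pi> \<pi> by standard
  have "AE w in \<pi>. AE v in \<pi>. \<bar>dens w v\<bar> \<le> B"
    using P.AE_pair[OF bnd] by simp
  then show ?thesis
  proof eventually_elim
    case (elim w)
    have "cmod (Pop f w) \<le> (\<integral>v. cmod (of_real (dens w v) * f v) \<partial>\<pi>)"
      unfolding Pop_def by (rule integral_norm_bound)
    also have "\<dots> \<le> (\<integral>v. B * cmod (f v) \<partial>\<pi>)"
    proof (rule integral_mono_AE)
      show "AE v in \<pi>. cmod (of_real (dens w v) * f v) \<le> B * cmod (f v)"
        using elim by eventually_elim (simp add: norm_mult mult_right_mono)
    qed (use Pop_integrable[OF f] bmeas_integrable_norm[OF f] in auto)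
    finally show ?case by simp
  qed
qed

lemma norm_integral_le:
  assumes f: "f \<in> bmeas" and c: "\<And>x. cmod (f x) \<le> c"
  shows "cmod (\<integral>x. f x \<partial>\<pi>) \<le> c"
proof -
  have "cmod (\<integral>x. f x \<partial>\<pi>) \<le> (\<integral>x. cmod (f x) \<partial>\<pi>)" by (rule integral_norm_bound)
  also have "\<dots> \<le> (\<integral>x. c \<partial>\<pi>)"
    by (rule integral_mono[OF bmeas_integrable_norm[OF f]]) (use c in auto)
  finally show ?thesis using prob_space by simp
qed

lemma norm_chain_fn_replicate_le:
  assumes g: "g \<in> bmeas" and g1: "\<And>x. cmod (g x) \<le> 1"
  shows "cmod (chain_fn (replicate n g) x) \<le> 1"
proof (induction n arbitrary: x)
  case (Suc n)
  have "chain_fn (replicate n g) \<in> bmeas" using g by (intro chain_fn_bmeas) auto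
  then have "cmod (Pop (chain_fn (replicate n g)) x) \<le> 1"
    using Suc by (intro Pop_norm_le bmeas_measurable)
  then show ?case
    using mult_mono[OF g1[of x], of _ 1] by (simp add: norm_mult)
qed simp

lemma norm_integral_chain_fn_le:
  assumes "g \<in> bmeas" "\<And>x. cmod (g x) \<le> 1"
  shows "cmod (\<integral>x. chain_fn (replicate n g) x \<partial>\<pi>) \<le> 1"
  by (intro norm_integral_le chain_fn_bmeas norm_chain_fn_replicate_le assms) (use assms in auto)

section \<open>Products along the chain\<close>

text \<open>Of the two L1 factors in the error, one comes from the fluctuation r n and the other
  from g - 1. \<open>K\<close> depends on the gap and the density bound but neither on g nor on n,
  so g may vary with N and p.\<close>

lemma chain_product_approx:
  assumes inv: "invariant \<pi> dens" and gap: "spectral_gap \<pi> dens"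
    and Linf: "\<exists>B. AE z in \<pi> \<Otimes>\<^sub>M \<pi>. \<bar>dens (fst z) (snd z)\<bar> \<le> B"
  obtains K where "0 \<le> K"
    "\<And>g n. g \<in> bmeas \<Longrightarrow> (\<And>x. cmod (g x) = 1) \<Longrightarrow>
      cmod ((\<integral>x. chain_fn (replicate n g) x \<partial>\<pi>) - (\<integral>x. g x \<partial>\<pi>) ^ n) \<le> real n * (K * (\<integral>x. cmod (g x - 1) \<partial>\<pi>)\<^sup>2)"
proof -
  obtain B0 where "AE z in \<pi> \<Otimes>\<^sub>M \<pi>. \<bar>dens (fst z) (snd z)\<bar> \<le> B0" using Linf by blast
  then have B: "AE z in \<pi> \<Otimes>\<^sub>M \<pi>. \<bar>dens (fst z) (snd z)\<bar> \<le> max 0 B0" by eventually_elim simp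
  define B where "B = max 0 B0"
  have B0: "0 \<le> B" by (simp add: B_def)
  obtain \<gamma> where \<gamma>: "0 \<le> \<gamma>" "\<gamma> < 1" and gap': "\<And>f. f \<in> borel_measurable \<pi> \<Longrightarrow> integrable \<pi> (\<lambda>x. (f x)\<^sup>2) \<Longrightarrow> (\<integral>x. f x \<partial>\<pi>) = 0 \<Longrightarrow>
        integrable \<pi> (\<lambda>x. (trans_op \<pi> dens f x)\<^sup>2) \<and>
        sqrt (\<integral>x. (trans_op \<pi> dens f x)\<^sup>2 \<partial>\<pi>) \<le> \<gamma> * sqrt (\<integral>x. (f x)\<^sup>2 \<partial>\<pi>)"
    using gap unfolding spectral_gap_def by blast
  txt \<open>The slack \<open>\<eta>\<close> absorbs the cross term of the squared norm while keeping \<open>(1 + \<eta>) * \<gamma>\<^sup>2 < 1\<close>.\<close>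
  define q where "q = \<gamma>\<^sup>2"
  have q: "0 \<le> q" "q < 1" using \<gamma> by (auto simp: q_def power_less_one_iff abs_square_less_1)
  define \<eta> where "\<eta> = (1 - q) / 2"
  define \<rho> where "\<rho> = (1 + \<eta>) * q"
  have \<eta>: "0 < \<eta>" using q by (simp add: \<eta>_def)
  have "1 - \<rho> = (1 - q) * (1 - q / 2)" by (simp add: \<rho>_def \<eta>_def field_simps)
  also have "\<dots> > 0" using q by (intro mult_pos_pos) auto
  finally have \<rho>: "\<rho> < 1" by simp
  have \<rho>0: "0 \<le> \<rho>" using q \<eta> by (simp add: \<rho>_def)
  \<comment> \<open>The fixed point of the affine recursion for the squared L2 norms, in units of
    \<open>a\<^sup>2\<close>; a bound by \<open>X * a\<^sup>2\<close> thus reproduces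
    itself.\<close>
  define X where "X = (1 + 1 / \<eta>) / (1 - \<rho>)"
  have X: "0 \<le> X" "(1 + 1 / \<eta>) + \<rho> * X = X" using \<eta> \<rho> by (auto simp: X_def field_simps)
  \<comment> \<open>With a = (B + 1) e this is a + (B + 1) sqrt X a, the sup bound in
    \<open>Linf_r\<close>, divided by e.\<close>
  define K where "K = (B + 1) * (1 + (B + 1) * sqrt X)"
  have K: "0 \<le> K" using B0 X by (simp add: K_def)
  have sup: "AE w in \<pi>. cmod (Pop f w - (\<integral>x. f x \<partial>\<pi>)) \<le> (B + 1) * (\<integral>x. cmod (f x) \<partial>\<pi>)" if "f \<in> bmeas" for f
    using Pop_L1_Linf[OF B[folded B_def] that]
  proof eventually_elim
    case (elim w)
    have "cmod (\<integral>x. f x \<partial>\<pi>) \<le> (\<integral>x. cmod (f x) \<partial>\<pi>)" by (rule integral_norm_bound)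
    then show ?case using elim norm_triangle_ineq4[of "Pop f w" "\<integral>x. f x \<partial>\<pi>"]
      unfolding distrib_right by linarith
  qed
  show ?thesis
  proof (rule that[OF K])
    fix g n assume g: "g \<in> bmeas" and g1: "\<And>x. cmod (g x) = 1"
    define e where "e = (\<integral>x. cmod (g x - 1) \<partial>\<pi>)"
    define m where "m n = (\<integral>x. chain_fn (replicate n g) x \<partial>\<pi>)" for n
    define u where "u n = Pop (chain_fn (replicate n g))" for n
    define r where "r n x = u n x - m n" for n x
    define a where "a = (B + 1) * e"
    have e0: "0 \<le> e" unfolding e_def by (intro Bochner_Integration.integral_nonneg) auto
    have a0: "0 \<le> a" using e0 B0 by (simp add: a_def)
    have cb: "chain_fn (replicate n g) \<in> bmeas" for n using g by (intro chain_fn_bmeas) auto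
    have ub: "u n \<in> bmeas" for n unfolding u_def by (rule Pop_bmeas[OF cb])
    have rb: "r n \<in> bmeas" for n using bmeas_diff[OF ub bmeas_const] by (simp add: r_def[abs_def])
    have grb: "(\<lambda>x. g x * r n x) \<in> bmeas" for n by (rule bmeas_mult[OF g rb])
    have gm1: "(\<lambda>x. g x - 1) \<in> bmeas" by (rule bmeas_diff[OF g bmeas_const])
    have m1: "cmod (m n) \<le> 1" for n
      unfolding m_def using g g1 by (intro norm_integral_chain_fn_le) auto
    have u0: "u 0 = (\<lambda>_. 1)" by (auto simp: u_def Pop_const)
    have m0: "m 0 = 1" using prob_space by (simp add: m_def)
    have uint: "(\<integral>x. u n x \<partial>\<pi>) = m n" for n unfolding u_def m_def by (rule integral_Pop[OF inv cb])
    have rint: "(\<integral>x. r n x \<partial>\<pi>) = 0" for n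
      unfolding r_def using bmeas_integrable[OF ub[of n]] uint prob_space by simp
    have gu: "g x * u n x = m n * g x + g x * r n x" for n x by (simp add: r_def algebra_simps)
    have cSuc: "chain_fn (replicate (Suc n) g) = (\<lambda>x. m n * g x + g x * r n x)" for n
      by (simp add: u_def[symmetric] gu)
    have mSuc: "m (Suc n) = m n * (\<integral>x. g x \<partial>\<pi>) + (\<integral>x. g x * r n x \<partial>\<pi>)" for n
      unfolding m_def[of "Suc n"] cSuc using bmeas_integrable[OF g] bmeas_integrable[OF grb[of n]] by simp
    \<comment> \<open>P - pi annihilates constants, so it may be applied to the small function g - 1
      instead of g.\<close>
    define s where "s w = Pop (\<lambda>x. g x - 1) w - (\<integral>x. g x - 1 \<partial>\<pi>)" for w
    \<comment> \<open>Centred so that the spectral gap applies; \<open>Pop (z n)\<close> is (P - pi)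
      (g * r n).\<close>
    define z where "z n x = g x * r n x - (\<integral>x. g x * r n x \<partial>\<pi>)" for n x
    have s_eq: "s w = Pop g w - (\<integral>x. g x \<partial>\<pi>)" for w
    proof -
      have "Pop (\<lambda>x. g x + (- 1)) w = Pop g w + (- 1)"
        by (subst Pop_add[OF g bmeas_const]) (simp add: Pop_const)
      then show ?thesis using bmeas_integrable[OF g] prob_space by (simp add: s_def)
    qed
    have zb: "z n \<in> bmeas" for n using bmeas_diff[OF grb bmeas_const] by (simp add: z_def[abs_def])
    have zint: "(\<integral>x. z n x \<partial>\<pi>) = 0" for n
      unfolding z_def using bmeas_integrable[OF grb[of n]] prob_space by simp
    have Pz: "Pop (z n) w = Pop (\<lambda>x. g x * r n x) w - (\<integral>x. g x * r n x \<partial>\<pi>)" for n w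
    proof -
      have "Pop (\<lambda>x. g x * r n x + (- (\<integral>x. g x * r n x \<partial>\<pi>))) w = Pop (\<lambda>x. g x * r n x) w + (- (\<integral>x. g x * r n x \<partial>\<pi>))"
        by (subst Pop_add[OF grb bmeas_const]) (simp add: Pop_const)
      then show ?thesis by (simp add: z_def[abs_def])
    qed
    have rSuc: "r (Suc n) w = m n * s w + Pop (z n) w" for n w
    proof -
      have "u (Suc n) w = m n * Pop g w + Pop (\<lambda>x. g x * r n x) w"
        unfolding u_def[of "Suc n"] cSuc Pop_add[OF bmeas_mult[OF bmeas_const g] grb] Pop_cmult ..
      then show ?thesis unfolding r_def[of "Suc n"] mSuc s_eq Pz by (simp add: algebra_simps)
    qed
    have sa: "AE w in \<pi>. cmod (s w) \<le> a"
      using sup[OF gm1] by (simp add: s_def a_def e_def)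
    have pa: "AE w in \<pi>. cmod (m n * s w) \<le> a" for n
      using sa
    proof eventually_elim
      case (elim w)
      show ?case using mult_mono[OF m1[of n] elim] by (simp add: norm_mult)
    qed
    define x where "x n = (\<integral>w. (cmod (r n w))\<^sup>2 \<partial>\<pi>)" for n
    \<comment> \<open>Multiplication by g preserves the L2 norm, centring does not increase it, and
      the operator then contracts its square by q.\<close>
    have xSuc: "x (Suc n) \<le> (1 + 1 / \<eta>) * a\<^sup>2 + \<rho> * x n" for n
    proof -
      have "x (Suc n) \<le> (\<integral>w. (1 + 1 / \<eta>) * a\<^sup>2 + (1 + \<eta>) * (cmod (Pop (z n) w))\<^sup>2 \<partial>\<pi>)"
        unfolding x_def
      proof (rule integral_mono_AE[OF bmeas_integrable_norm_sq[OF rb]])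
        show "integrable \<pi> (\<lambda>w. (1 + 1 / \<eta>) * a\<^sup>2 + (1 + \<eta>) * (cmod (Pop (z n) w))\<^sup>2)"
          using bmeas_integrable_norm_sq[OF Pop_bmeas[OF zb[of n]]] by simp
        show "AE w in \<pi>. (cmod (r (Suc n) w))\<^sup>2 \<le> (1 + 1 / \<eta>) * a\<^sup>2 + (1 + \<eta>) * (cmod (Pop (z n) w))\<^sup>2"
          using pa[of n]
        proof eventually_elim
          case (elim w)
          have "(1 + 1 / \<eta>) * (cmod (m n * s w))\<^sup>2 \<le> (1 + 1 / \<eta>) * a\<^sup>2"
            using elim \<eta> by (intro mult_left_mono power_mono) auto
          then show ?case unfolding rSuc using norm_add_sq_le[OF \<eta>, of "m n * s w" "Pop (z n) w"] by linarith
        qed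
      qed
      also have "\<dots> = (1 + 1 / \<eta>) * a\<^sup>2 + (1 + \<eta>) * (\<integral>w. (cmod (Pop (z n) w))\<^sup>2 \<partial>\<pi>)"
        using bmeas_integrable_norm_sq[OF Pop_bmeas[OF zb[of n]]] prob_space by simp
      also have "(\<integral>w. (cmod (Pop (z n) w))\<^sup>2 \<partial>\<pi>) \<le> q * (\<integral>w. (cmod (z n w))\<^sup>2 \<partial>\<pi>)"
        unfolding q_def by (rule Pop_L2_contraction[OF gap' zb zint])
      also have "(\<integral>w. (cmod (z n w))\<^sup>2 \<partial>\<pi>) \<le> (\<integral>w. (cmod (g w * r n w))\<^sup>2 \<partial>\<pi>)"
        unfolding z_def by (rule integral_norm_sq_center_le[OF grb])
      also have "\<dots> = x n" unfolding x_def by (simp add: norm_mult g1)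
      finally show ?thesis using \<eta> q by (simp add: \<rho>_def mult_left_mono mult.assoc)
    qed
    have xb: "x n \<le> X * a\<^sup>2" for n
    proof (induction n)
      case 0
      show ?case using X by (simp add: x_def r_def u0 m0)
    next
      case (Suc n)
      have "x (Suc n) \<le> (1 + 1 / \<eta>) * a\<^sup>2 + \<rho> * (X * a\<^sup>2)"
        using xSuc[of n] mult_left_mono[OF Suc \<rho>0] by linarith
      also have "\<dots> = ((1 + 1 / \<eta>) + \<rho> * X) * a\<^sup>2" by (simp add: algebra_simps)
      finally show ?case unfolding X(2) .
    qed
    have L1: "(\<integral>w. cmod (r n w) \<partial>\<pi>) \<le> sqrt X * a" for n
    proof -
      have "(\<integral>w. cmod (r n w) \<partial>\<pi>) \<le> sqrt (x n)" unfolding x_def by (rule integral_norm_le_sqrt[OF rb])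
      also have "\<dots> \<le> sqrt (X * a\<^sup>2)" using xb by simp
      also have "\<dots> = sqrt X * a" using a0 by (simp add: real_sqrt_mult)
      finally show ?thesis .
    qed
    \<comment> \<open>\<open>r 0\<close> vanishes; any later \<open>r\<close> is a forcing term plus
      P - pi applied to \<open>g * r k\<close>, whose L1 norm is controlled by \<open>L1\<close> one
      step earlier.\<close>
    have Linf_r: "AE w in \<pi>. cmod (r n w) \<le> K * e" for n
    proof (cases n)
      case 0
      then show ?thesis using K e0 by (simp add: r_def u0 m0)
    next
      case (Suc k)
      have "AE w in \<pi>. cmod (Pop (z k) w) \<le> (B + 1) * (\<integral>x. cmod (r k x) \<partial>\<pi>)"
        using sup[OF grb[of k]] unfolding Pz[symmetric] by (simp add: norm_mult g1)
      with pa[of k] show ?thesis unfolding Suc rSuc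
      proof eventually_elim
        case (elim w)
        have "cmod (m k * s w + Pop (z k) w) \<le> a + (B + 1) * (\<integral>x. cmod (r k x) \<partial>\<pi>)"
          using elim by (intro norm_triangle_le add_mono)
        also have "\<dots> \<le> a + (B + 1) * (sqrt X * a)" using L1 B0 by (intro add_left_mono mult_left_mono) auto
        also have "\<dots> = K * e" by (simp add: K_def a_def algebra_simps)
        finally show ?case .
      qed
    qed
    have step: "cmod (m (Suc n) - m n * (\<integral>x. g x \<partial>\<pi>)) \<le> K * e\<^sup>2" for n
    proof -
      \<comment> \<open>Subtracting the zero mean of \<open>r n\<close> replaces g by g - 1, which
        supplies the second factor e.\<close>
      have "m (Suc n) - m n * (\<integral>x. g x \<partial>\<pi>) = (\<integral>x. g x * r n x \<partial>\<pi>) - (\<integral>x. r n x \<partial>\<pi>)"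
        by (simp add: mSuc rint)
      also have "\<dots> = (\<integral>x. (g x - 1) * r n x \<partial>\<pi>)"
        using bmeas_integrable[OF grb[of n]] bmeas_integrable[OF rb[of n]] by (simp add: left_diff_distrib)
      also have "cmod \<dots> \<le> (\<integral>x. cmod ((g x - 1) * r n x) \<partial>\<pi>)" by (rule integral_norm_bound)
      also have "\<dots> \<le> (\<integral>x. K * e * cmod (g x - 1) \<partial>\<pi>)"
      proof (rule integral_mono_AE[OF bmeas_integrable_norm[OF bmeas_mult[OF gm1 rb]]])
        show "integrable \<pi> (\<lambda>x. K * e * cmod (g x - 1))" using bmeas_integrable_norm[OF gm1] by simp
        show "AE x in \<pi>. cmod ((g x - 1) * r n x) \<le> K * e * cmod (g x - 1)"
          using Linf_r[of n] by eventually_elim (metis norm_mult mult.commute mult_right_mono norm_ge_zero)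
      qed
      also have "\<dots> = K * e\<^sup>2" by (simp add: e_def power2_eq_square)
      finally show ?thesis .
    qed
    have G1: "cmod (\<integral>x. g x \<partial>\<pi>) \<le> 1" by (rule norm_integral_le[OF g]) (simp add: g1)
    have "cmod (m n - (\<integral>x. g x \<partial>\<pi>) ^ n) \<le> real n * (K * e\<^sup>2)" for n
    proof (induction n)
      case (Suc n)
      let ?G = "\<integral>x. g x \<partial>\<pi>"
      \<comment> \<open>One new defect plus the old error, which is not amplified because
        \<open>cmod ?G\<close> is at most 1.\<close>
      have "m (Suc n) - ?G ^ Suc n = (m (Suc n) - m n * ?G) + (m n - ?G ^ n) * ?G"
        by (simp add: algebra_simps)
      also have "cmod \<dots> \<le> K * e\<^sup>2 + real n * (K * e\<^sup>2) * 1"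
        using mult_mono[OF Suc G1] step[of n] K by (intro norm_triangle_le add_mono) (simp_all add: norm_mult)
      finally show ?case by (simp add: algebra_simps)
    qed (simp add: m0)
    then show "cmod ((\<integral>x. chain_fn (replicate n g) x \<partial>\<pi>) - (\<integral>x. g x \<partial>\<pi>) ^ n) \<le> real n * (K * (\<integral>x. cmod (g x - 1) \<partial>\<pi>)\<^sup>2)"
      unfolding m_def e_def .
  qed
qed

end

section \<open>The convergence rate\<close>

lemma cis_sum: "cis (\<Sum>k\<in>A. f k) = (\<Prod>k\<in>A. cis (f k))"
  by (induction A rule: infinite_finite_induct) (simp_all flip: cis_mult)

theorem theorem5p2:
  fixes \<pi> :: "'a::polish_space measure"
    and M :: "'w measure"
    and \<xi> :: "nat \<Rightarrow> 'w \<Rightarrow> 'a"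
    and dens :: "'a \<Rightarrow> 'a \<Rightarrow> real"
    and \<Psi> :: "'a \<Rightarrow> real"
    and \<alpha> \<alpha>1 cp cm Cstar :: real
  assumes M: "prob_space M"
    and pi: "prob_space \<pi>" "sets \<pi> = sets borel"
    and dens_meas: "(\<lambda>z. dens (fst z) (snd z)) \<in> borel_measurable (\<pi> \<Otimes>\<^sub>M \<pi>)"
    and dens_nonneg: "\<And>w. AE v in \<pi>. 0 \<le> dens w v"
    and dens_int: "\<And>w. integrable \<pi> (dens w)" "\<And>w. (\<integral>v. dens w v \<partial>\<pi>) = 1"
    and dens_Linf: "\<exists>B. AE z in \<pi> \<Otimes>\<^sub>M \<pi>. \<bar>dens (fst z) (snd z)\<bar> \<le> B"
    and chain: "markov_chain M \<xi> \<pi> dens"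
    and inv: "invariant \<pi> dens"
    and erg: "ergodic \<pi> dens"
    and gap: "spectral_gap \<pi> dens"
    and Psi_meas: "\<Psi> \<in> borel_measurable \<pi>"
    and Psi_int: "integrable \<pi> \<Psi>" "(\<integral>x. \<Psi> x \<partial>\<pi>) = 0"
    and alpha: "1 < \<alpha>" "\<alpha> < 2"
    and alpha1: "0 < \<alpha>1" "\<alpha>1 < 2 - \<alpha>"
    and cpm: "0 \<le> cp" "0 \<le> cm" "0 < cp + cm"
    and Cstar: "0 < Cstar"
    and tails: "\<And>s. 1 \<le> s \<Longrightarrow>
       \<bar>measure \<pi> {x \<in> space \<pi>. \<Psi> x > s} - cp / s powr \<alpha>\<bar>
       + \<bar>measure \<pi> {x \<in> space \<pi>. \<Psi> x < - s} - cm / s powr \<alpha>\<bar>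
       \<le> Cstar / s powr (\<alpha> + \<alpha>1)"
  shows "\<forall>\<delta>. 0 < \<delta> \<and> \<delta> < \<alpha> / (\<alpha> + 1) \<longrightarrow>
     (\<exists>C>0. \<forall>p t N. 0 \<le> t \<longrightarrow> 1 \<le> N \<longrightarrow>
        cmod ((\<integral>\<omega>. cis (p * Zproc \<alpha> \<Psi> \<xi> N t \<omega>) \<partial>M)
              - exp (- complex_of_real t * levy_exponent \<alpha> cp cm p))
        \<le> C * (1 + \<bar>p\<bar>) ^ 5 * (t + 1) *
           (1 / real N powr (\<alpha>1 / \<alpha>) + 1 / real N powr \<delta>))"
proof -
  interpret pi: prob_space \<pi> by fact
  interpret M: prob_space M by fact
  have space: "space \<pi> = UNIV" using sets_eq_imp_space_eq[OF pi(2)] by simp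
  interpret markov_density \<pi> dens
    by unfold_locales (use space dens_meas dens_nonneg dens_int in auto)
  obtain K1 where K1: "0 \<le> K1" "\<And>g n. g \<in> bmeas \<Longrightarrow> (\<And>x. cmod (g x) = 1) \<Longrightarrow>
      cmod ((\<integral>x. chain_fn (replicate n g) x \<partial>\<pi>) - (\<integral>x. g x \<partial>\<pi>) ^ n) \<le> real n * (K1 * (\<integral>x. cmod (g x - 1) \<partial>\<pi>)\<^sup>2)"
    using chain_product_approx[OF inv gap dens_Linf] by blast
  obtain K2 where K2: "0 \<le> K2"
    "\<And>h. cmod ((\<integral>x. cis (h * \<Psi> x) \<partial>\<pi>) - exp (- levy_exponent \<alpha> cp cm h)) \<le> K2 * \<bar>h\<bar> powr (\<alpha> + \<alpha>1)"
    using pi.norm_char_minus_exp_levy_le[OF Psi_meas Psi_int alpha alpha1 cpm(1,2) Cstar tails] by blast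
  define b where "b = \<alpha> + \<alpha>1"
  have b: "1 < b" "b < 2" using alpha alpha1 by (auto simp: b_def)
  define \<kappa> where "\<kappa> = (\<integral>x. \<bar>\<Psi> x\<bar> \<partial>\<pi>)"
  define L where "L = (cp + cm) * tail_const \<alpha>"
  \<comment> \<open>\<open>K1 * \<kappa>\<^sup>2\<close> serves |h| <= 1, and 2 is the trivial bound
    for |h| > 1.\<close>
  define C1 where "C1 = K1 * \<kappa>\<^sup>2 + 2"
  have C1: "2 \<le> C1" "0 \<le> C1" using K1 by (auto simp: C1_def)
  have L0: "0 \<le> L" using cpm tail_const_nonneg[of \<alpha>] by (simp add: L_def)
  define C where "C = C1 + K2 + L + 1"
  have C: "0 < C" using C1 K2 L0 by (simp add: C_def)
  let ?\<psi> = "levy_exponent \<alpha> cp cm"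
  have re: "0 \<le> Re (?\<psi> h)" for h by (rule Re_levy_exponent_nonneg[OF alpha cpm(1,2)])
  define g where "g h x = cis (h * \<Psi> x)" for h x
  have gb: "g h \<in> bmeas" for h
    unfolding g_def[abs_def] using Psi_meas by (intro bmeasI[of _ 1]) auto
  have g1: "cmod (g h x) = 1" for h x by (simp add: g_def)
  have gL1: "(\<integral>x. cmod (g h x - 1) \<partial>\<pi>) \<le> \<bar>h\<bar> * \<kappa>" for h
  proof -
    have "(\<integral>x. cmod (g h x - 1) \<partial>\<pi>) \<le> (\<integral>x. \<bar>h\<bar> * \<bar>\<Psi> x\<bar> \<partial>\<pi>)"
    proof (rule integral_mono)
      show "integrable \<pi> (\<lambda>x. cmod (g h x - 1))"
        by (rule bmeas_integrable_norm[OF bmeas_diff[OF gb bmeas_const]])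
      show "integrable \<pi> (\<lambda>x. \<bar>h\<bar> * \<bar>\<Psi> x\<bar>)" using Psi_int by simp
      show "cmod (g h x - 1) \<le> \<bar>h\<bar> * \<bar>\<Psi> x\<bar>" for x
        using norm_cis_diff_1_le[of "h * \<Psi> x"] by (simp add: g_def abs_mult)
    qed
    then show ?thesis by (simp add: \<kappa>_def)
  qed
  have G1: "cmod (\<integral>x. g h x \<partial>\<pi>) \<le> 1" for h by (rule norm_integral_le[OF gb]) (simp add: g1)
  have sum_err: "cmod ((\<integral>x. chain_fn (replicate (Suc n) (g h)) x \<partial>\<pi>) - exp (- ?\<psi> h) ^ Suc n)
      \<le> real (Suc n) * ((C1 + K2) * \<bar>h\<bar> powr b)" for n h
  proof -
    let ?G = "\<integral>x. g h x \<partial>\<pi>" and ?E = "\<integral>x. chain_fn (replicate (Suc n) (g h)) x \<partial>\<pi>"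
    have "cmod (?E - ?G ^ Suc n) \<le> real (Suc n) * (C1 * \<bar>h\<bar> powr b)"
    proof (cases "\<bar>h\<bar> \<le> 1")
      case True
      have "(\<integral>x. cmod (g h x - 1) \<partial>\<pi>)\<^sup>2 \<le> (\<bar>h\<bar> * \<kappa>)\<^sup>2"
        by (intro power_mono gL1 Bochner_Integration.integral_nonneg) auto
      also have "\<dots> = \<kappa>\<^sup>2 * \<bar>h\<bar> powr 2" by (cases "h = 0") (auto simp: power_mult_distrib)
      also have "\<dots> \<le> \<kappa>\<^sup>2 * \<bar>h\<bar> powr b" using True b by (intro mult_left_mono powr_mono') auto
      finally have "K1 * (\<integral>x. cmod (g h x - 1) \<partial>\<pi>)\<^sup>2 \<le> K1 * (\<kappa>\<^sup>2 * \<bar>h\<bar> powr b)"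
        using K1(1) by (rule mult_left_mono)
      also have "\<dots> \<le> C1 * \<bar>h\<bar> powr b" by (simp add: C1_def algebra_simps)
      finally have "real (Suc n) * (K1 * (\<integral>x. cmod (g h x - 1) \<partial>\<pi>)\<^sup>2) \<le> real (Suc n) * (C1 * \<bar>h\<bar> powr b)"
        by (rule mult_left_mono) simp
      with K1(2)[OF gb g1] show ?thesis by (rule order_trans)
    next
      case False
      have "cmod ?E \<le> 1" by (rule norm_integral_chain_fn_le) (use gb g1 in auto)
      moreover have "cmod (?G ^ Suc n) \<le> 1" unfolding norm_power using G1[of h] by (intro power_le_one) auto
      ultimately have "cmod (?E - ?G ^ Suc n) \<le> 2"
        using norm_triangle_ineq4[of ?E "?G ^ Suc n"] by linarith
      also have "2 \<le> C1 * \<bar>h\<bar> powr b"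
        using mult_mono[OF C1(1) ge_one_powr_ge_zero[of "\<bar>h\<bar>" b]] False b C1 by simp
      also have "\<dots> \<le> real (Suc n) * (C1 * \<bar>h\<bar> powr b)"
        using mult_right_mono[of 1 "real (Suc n)" "C1 * \<bar>h\<bar> powr b"] C1 by simp
      finally show ?thesis .
    qed
    moreover have "cmod (?G ^ Suc n - exp (- ?\<psi> h) ^ Suc n) \<le> real (Suc n) * (K2 * \<bar>h\<bar> powr b)"
    proof -
      \<comment> \<open>Both bases lie in the closed unit disc, so taking a power multiplies their
        distance by at most the exponent.\<close>
      have "cmod (?G ^ Suc n - exp (- ?\<psi> h) ^ Suc n) \<le> real (Suc n) * cmod (?G - exp (- ?\<psi> h))"
        using G1[of h] re[of h] by (intro norm_power_diff) auto
      also have "\<dots> \<le> real (Suc n) * (K2 * \<bar>h\<bar> powr b)"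
        using K2(2)[of h] by (intro mult_left_mono) (auto simp: b_def g_def)
      finally show ?thesis .
    qed
    ultimately show ?thesis
      using norm_triangle_ineq[of "?E - ?G ^ Suc n" "?G ^ Suc n - exp (- ?\<psi> h) ^ Suc n"] by (simp add: algebra_simps)
  qed
  have pow5: "\<bar>p\<bar> powr a \<le> (1 + \<bar>p\<bar>) ^ 5" if "0 \<le> a" "a \<le> 5" for p a :: real
  proof -
    have "\<bar>p\<bar> powr a \<le> (1 + \<bar>p\<bar>) powr a" using that by (intro powr_mono2) auto
    also have "\<dots> \<le> (1 + \<bar>p\<bar>) powr 5" using that by (intro powr_mono) auto
    also have "\<dots> = (1 + \<bar>p\<bar>) ^ 5" using powr_realpow[of "1 + \<bar>p\<bar>" 5] by simp
    finally show ?thesis .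
  qed
  have bound: "cmod ((\<integral>\<omega>. cis (p * Zproc \<alpha> \<Psi> \<xi> N t \<omega>) \<partial>M) - exp (- complex_of_real t * ?\<psi> p))
        \<le> C * (1 + \<bar>p\<bar>) ^ 5 * (t + 1) * (1 / real N powr (\<alpha>1 / \<alpha>))"
    if t: "0 \<le> t" and N: "1 \<le> N" for p t :: real and N :: nat
  proof -
    \<comment> \<open>The index of the last summand; the sum starts at 0, hence the
      \<open>Suc n\<close> factors below.\<close>
    define n where "n = nat \<lfloor>real N * t\<rfloor>"
    define c where "c = real N powr (- 1 / \<alpha>)"
    define h where "h = c * p"
    define R where "R = 1 / real N powr (\<alpha>1 / \<alpha>)"
    have R: "R = real N powr (- (\<alpha>1 / \<alpha>))" by (simp add: R_def powr_minus_divide)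
    have c0: "0 < c" using N by (simp add: c_def)
    have c\<alpha>: "c powr \<alpha> = 1 / real N"
      unfolding c_def powr_powr using N alpha powr_minus_divide[of "real N" 1] by simp
    have E: "(\<integral>\<omega>. cis (p * Zproc \<alpha> \<Psi> \<xi> N t \<omega>) \<partial>M) = (\<integral>x. chain_fn (replicate (Suc n) (g h)) x \<partial>\<pi>)"
    proof -
      have "cis (p * Zproc \<alpha> \<Psi> \<xi> N t \<omega>) = (\<Prod>k<length (replicate (Suc n) (g h)). (replicate (Suc n) (g h) ! k) (\<xi> k \<omega>))" for \<omega>
      proof -
        have "p * Zproc \<alpha> \<Psi> \<xi> N t \<omega> = (\<Sum>k<Suc n. h * \<Psi> (\<xi> k \<omega>))"
          by (simp add: Zproc_def h_def c_def n_def sum_distrib_left atLeast0AtMost lessThan_Suc_atMost mult_ac)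
        then have "cis (p * Zproc \<alpha> \<Psi> \<xi> N t \<omega>) = (\<Prod>k<Suc n. g h (\<xi> k \<omega>))"
          by (simp only: cis_sum g_def)
        also have "\<dots> = (\<Prod>k<length (replicate (Suc n) (g h)). (replicate (Suc n) (g h) ! k) (\<xi> k \<omega>))"
          by (intro prod.cong) (auto simp del: replicate_Suc)
        finally show ?thesis .
      qed
      then show ?thesis
        using chain_expectation[OF M chain, of "replicate (Suc n) (g h)"] gb by (simp del: replicate_Suc)
    qed
    \<comment> \<open>Self-similarity of the exponent with \<open>c powr \<alpha>\<close> equal to
      1/N.\<close>
    have \<psi>h: "?\<psi> h = of_real (1 / real N) * ?\<psi> p"
      unfolding h_def levy_exponent_scale[OF c0] c\<alpha> ..
    have pw: "exp (- ?\<psi> h) ^ Suc n = exp (- (of_real (real (Suc n) / real N) * ?\<psi> p))"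
      unfolding exp_of_nat_mult[symmetric] \<psi>h by (rule arg_cong[where f=exp]) simp
    have nl: "real N * t < real (Suc n)" "real (Suc n) \<le> real N * t + 1"
    proof -
      have "real n = of_int \<lfloor>real N * t\<rfloor>" using t by (simp add: n_def)
      then show "real N * t < real (Suc n)" "real (Suc n) \<le> real N * t + 1" by linarith+
    qed
    have "cmod (exp (- (of_real (real (Suc n) / real N) * ?\<psi> p)) - exp (- complex_of_real t * ?\<psi> p))
        \<le> cmod (- (of_real (real (Suc n) / real N) * ?\<psi> p) - (- complex_of_real t * ?\<psi> p))"
    proof (rule exp_lipschitz_Re_nonpos)
      have "0 \<le> real (Suc n) / real N * Re (?\<psi> p)" using re by (intro mult_nonneg_nonneg) auto
      then show "Re (- (of_real (real (Suc n) / real N) * ?\<psi> p)) \<le> 0" by simp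
      show "Re (- complex_of_real t * ?\<psi> p) \<le> 0" using mult_nonneg_nonneg[OF t re[of p]] by simp
    qed
    also have "- (of_real (real (Suc n) / real N) * ?\<psi> p) - (- complex_of_real t * ?\<psi> p) = of_real (t - real (Suc n) / real N) * ?\<psi> p"
      by (simp add: algebra_simps)
    also have "cmod \<dots> = \<bar>t - real (Suc n) / real N\<bar> * cmod (?\<psi> p)" by (simp only: norm_mult norm_of_real)
    also have "\<dots> \<le> R * (L * (1 + \<bar>p\<bar>) ^ 5)"
    proof (rule mult_mono)
      have "\<bar>t - real (Suc n) / real N\<bar> \<le> 1 / real N"
        using nl N by (simp add: abs_le_iff field_simps)
      also have "\<dots> = real N powr - 1" using N by (simp add: powr_minus_divide)
      \<comment> \<open>Here alpha1 < 2 - alpha < 1 < alpha, so the rounding error 1/N is within the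
        rate.\<close>
      also have "\<dots> \<le> R" unfolding R using N alpha alpha1 by (intro powr_mono) auto
      finally show "\<bar>t - real (Suc n) / real N\<bar> \<le> R" .
      have "cmod (?\<psi> p) \<le> L * \<bar>p\<bar> powr \<alpha>" using levy_exponent_bound[OF alpha cpm(1,2)] by (simp add: L_def)
      also have "\<dots> \<le> L * (1 + \<bar>p\<bar>) ^ 5" using L0 alpha by (intro mult_left_mono pow5) auto
      finally show "cmod (?\<psi> p) \<le> L * (1 + \<bar>p\<bar>) ^ 5" .
    qed (auto simp: R_def)
    finally have e3: "cmod (exp (- ?\<psi> h) ^ Suc n - exp (- complex_of_real t * ?\<psi> p)) \<le> R * (L * (1 + \<bar>p\<bar>) ^ 5)"
      unfolding pw .
    have h_powr: "\<bar>h\<bar> powr b = real N powr (- b / \<alpha>) * \<bar>p\<bar> powr b"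
      using c0 by (simp add: h_def abs_mult powr_mult) (simp add: c_def powr_powr)
    have "real (Suc n) * ((C1 + K2) * \<bar>h\<bar> powr b) \<le> (real N * (t + 1)) * ((C1 + K2) * \<bar>h\<bar> powr b)"
    proof (rule mult_right_mono)
      show "real (Suc n) \<le> real N * (t + 1)" using nl N by (simp add: distrib_left)
    qed (use C1 K2 in auto)
    also have "\<dots>
      = (real N powr 1 * real N powr (- b / \<alpha>)) * ((C1 + K2) * (t + 1) * \<bar>p\<bar> powr b)"
      unfolding h_powr using N by simp
    \<comment> \<open>1 - b / alpha = - alpha1 / alpha: the number of steps times the loss per
      step.\<close>
    also have "real N powr 1 * real N powr (- b / \<alpha>) = R"
      unfolding R powr_add[symmetric] using alpha by (intro arg_cong[where f="\<lambda>x. real N powr x"]) (simp add: b_def field_simps)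
    also have "R * ((C1 + K2) * (t + 1) * \<bar>p\<bar> powr b) \<le> R * ((C1 + K2) * (t + 1) * (1 + \<bar>p\<bar>) ^ 5)"
      using C1 K2 t b by (intro mult_left_mono pow5) (auto simp: R_def)
    finally have e12: "cmod ((\<integral>x. chain_fn (replicate (Suc n) (g h)) x \<partial>\<pi>) - exp (- ?\<psi> h) ^ Suc n) \<le> R * ((C1 + K2) * (t + 1) * (1 + \<bar>p\<bar>) ^ 5)"
      using sum_err[of n h] by linarith
    have "cmod ((\<integral>x. chain_fn (replicate (Suc n) (g h)) x \<partial>\<pi>) - exp (- complex_of_real t * ?\<psi> p))
       \<le> R * ((C1 + K2) * (t + 1) * (1 + \<bar>p\<bar>) ^ 5) + R * (L * (1 + \<bar>p\<bar>) ^ 5)"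
      using e12 e3 by (rule norm_diff_triangle_le)
    also have "\<dots> = R * (1 + \<bar>p\<bar>) ^ 5 * ((C1 + K2) * (t + 1) + L)" by (simp add: algebra_simps)
    also have "\<dots> \<le> R * (1 + \<bar>p\<bar>) ^ 5 * (C * (t + 1))"
    proof (rule mult_left_mono)
      have "L * 1 \<le> L * (t + 1)" using L0 t by (intro mult_left_mono) auto
      then show "(C1 + K2) * (t + 1) + L \<le> C * (t + 1)" using t by (simp add: C_def algebra_simps)
    qed (auto simp: R_def)
    finally show ?thesis unfolding E R_def[symmetric] by (simp only: mult_ac)
  qed
  show ?thesis
  proof (intro allI impI)
    \<comment> \<open>\<open>C\<close> was chosen before \<delta>, so one constant serves them
      all.\<close>
    fix \<delta> :: real
    have "cmod ((\<integral>\<omega>. cis (p * Zproc \<alpha> \<Psi> \<xi> N t \<omega>) \<partial>M) - exp (- complex_of_real t * ?\<psi> p))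
        \<le> C * (1 + \<bar>p\<bar>) ^ 5 * (t + 1) * (1 / real N powr (\<alpha>1 / \<alpha>) + 1 / real N powr \<delta>)"
      if "0 \<le> t" "1 \<le> N" for p t :: real and N :: nat
    proof -
      have "0 \<le> C * (1 + \<bar>p\<bar>) ^ 5 * (t + 1) * (1 / real N powr \<delta>)"
        using C that by (intro mult_nonneg_nonneg) auto
      then show ?thesis using bound[OF that, of p] unfolding distrib_left by linarith
    qed
    with C show "\<exists>C>0. \<forall>p t N. 0 \<le> t \<longrightarrow> 1 \<le> N \<longrightarrow>
        cmod ((\<integral>\<omega>. cis (p * Zproc \<alpha> \<Psi> \<xi> N t \<omega>) \<partial>M) - exp (- complex_of_real t * ?\<psi> p))
        \<le> C * (1 + \<bar>p\<bar>) ^ 5 * (t + 1) * (1 / real N powr (\<alpha>1 / \<alpha>) + 1 / real N powr \<delta>)"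
      by blast
  qed
qed

end
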